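(* Let $G$ be a finite graph (loops and multiple edges allowed), let $C$ be a circuit of $G$, and let $\omega: E(G)\to \mathbb{Z}^+$ be a weight function with $\omega(C)=\sum_{e\in E(C)}\omega(e)\le 35$. If there is a $\mathbb{Z}_2\times\mathbb{Z}_2$-flow $f$ in $G$ such that $E(G)\setminus E(C)\subseteq \mathrm{supp}(f)$, then there is a $\mathbb{Z}_2\times\mathbb{Z}_2$-flow $g$ in $G$ such that $E(G)\setminus E(C)\subseteq \mathrm{supp}(g)$ and $$\omega\big(E_{g=(0,0)}(C)\big)<\tfrac{1}{4}\,\omega(C),$$ where $E_{g=(0,0)}(C)=\{e\in E(C): g(e)=(0,0)\}$ and $\omega(F)=\sum_{e\in F}\omega(e)$ for a set of edges $F$.
   Context: A circuit is a connected 2-regular graph. For an abelian group $\Gamma$, a $\Gamma$-flow of $G$ is a pair $(D,f)$ where $D$ is an orientation of $G$ and $f:E(G)\to\Gamma$ satisfies, at every vertex $v$, $\sum_{e \text{ with tail } v} f(e)=\sum_{e\text{ with head } v} f(e)$. For $\Gamma=\mathbb{Z}_2\times\mathbb{Z}_2$ the orientation is irrelevant (every element is its own inverse), so the flow is denoted simply by $f$. The support is $\mathrm{supp}(f)=\{e\in E(G): f(e)\neq (0,0)\}$. *)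

theory Defs
  imports "Graph_Theory.Digraph" "HOL-Library.Uprod" "HOL-Library.Z2" "HOL-Library.Product_Plus"
    Complex_Main
begin

text \<open>Graphs with loops and multiple edges. Each edge has an unordered pair of ends;
  an edge with ends \<open>Upair v v\<close> is a loop at \<open>v\<close>.\<close>

record ('v, 'e) multigraph =
  vertices :: "'v set"
  edges :: "'e set"
  ends :: "'e \<Rightarrow> 'v uprod"

locale multigraph =
  fixes G :: "('v, 'e) multigraph"
  assumes ends_in_vertices: "e \<in> edges G \<Longrightarrow> set_uprod (ends G e) \<subseteq> vertices G"

locale finite_multigraph = multigraph G for G :: "('v, 'e) multigraph" +
  assumes finite_vertices: "finite (vertices G)"
    and finite_edges: "finite (edges G)"

definition subgraph_of :: "('v, 'e) multigraph \<Rightarrow> ('v, 'e) multigraph \<Rightarrow> bool" where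
  "subgraph_of H G \<longleftrightarrow>
     multigraph H \<and> vertices H \<subseteq> vertices G \<and> edges H \<subseteq> edges G \<and>
     (\<forall>e \<in> edges H. ends H e = ends G e)"

text \<open>A loop contributes 2 to the degree of its vertex.\<close>

definition degree :: "('v, 'e) multigraph \<Rightarrow> 'v \<Rightarrow> nat" where
  "degree G v =
     card {e \<in> edges G. v \<in> set_uprod (ends G e)} + card {e \<in> edges G. ends G e = Upair v v}"

definition adjacency :: "('v, 'e) multigraph \<Rightarrow> ('v \<times> 'v) set" where
  "adjacency G = {(u, v). \<exists>e \<in> edges G. ends G e = Upair u v}"

definition connected_graph :: "('v, 'e) multigraph \<Rightarrow> bool" where
  "connected_graph G \<longleftrightarrow>
     vertices G \<noteq> {} \<and> (\<forall>u \<in> vertices G. \<forall>v \<in> vertices G. (u, v) \<in> (adjacency G)\<^sup>*)"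

definition regular :: "nat \<Rightarrow> ('v, 'e) multigraph \<Rightarrow> bool" where
  "regular k G \<longleftrightarrow> (\<forall>v \<in> vertices G. degree G v = k)"

definition circuit :: "('v, 'e) multigraph \<Rightarrow> bool" where
  "circuit C \<longleftrightarrow> finite_multigraph C \<and> connected_graph C \<and> regular 2 C"

definition circuit_of :: "('v, 'e) multigraph \<Rightarrow> ('v, 'e) multigraph \<Rightarrow> bool" where
  "circuit_of C G \<longleftrightarrow> circuit C \<and> subgraph_of C G"

definition orientation :: "('v, 'e) multigraph \<Rightarrow> ('v, 'e) pre_digraph \<Rightarrow> bool" where
  "orientation G D \<longleftrightarrow>
     verts D = vertices G \<and> arcs D = edges G \<and>
     (\<forall>e \<in> edges G. Upair (tail D e) (head D e) = ends G e)"

definition is_flow ::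
  "('v, 'e) multigraph \<Rightarrow> ('v, 'e) pre_digraph \<Rightarrow> ('e \<Rightarrow> 'g::ab_group_add) \<Rightarrow> bool" where
  "is_flow G D f \<longleftrightarrow>
     orientation G D \<and>
     (\<forall>v \<in> vertices G. (\<Sum>e \<in> out_arcs D v. f e) = (\<Sum>e \<in> in_arcs D v. f e))"

text \<open>Every element of \<open>bit \<times> bit\<close> is its own inverse, so the condition does not
  depend on the orientation and a flow is identified with its edge function.\<close>

definition Z2Z2_flow :: "('v, 'e) multigraph \<Rightarrow> ('e \<Rightarrow> bit \<times> bit) \<Rightarrow> bool" where
  "Z2Z2_flow G f \<longleftrightarrow> (\<exists>D. is_flow G D f)"

definition supp :: "('v, 'e) multigraph \<Rightarrow> ('e \<Rightarrow> 'g::zero) \<Rightarrow> 'e set" where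
  "supp G f = {e \<in> edges G. f e \<noteq> 0}"

end

theory Submission imports Defs
begin

text \<open>
  Adding a constant along \<open>C\<close> permutes the four values of a flow on \<open>C\<close>, so if no flow is as
  required, then for every flow \<open>g\<close> that vanishes nowhere off \<open>C\<close> each value takes exactly a
  quarter of \<open>\<omega>(C)\<close>. Read \<open>g\<close> around \<open>C\<close> as a product of the shears \<open>[1 s; 0 1]\<close> and \<open>[1 0; s 1]\<close>,
  where the first coordinate of \<open>g\<close> chooses the shear and the second one the sign of
  \<open>s = \<plusminus>\<omega>(e)\<close>.

  A Kempe switch in the second coordinate flips the sign along an arc of \<open>C\<close> whose ends lie in
  one component of the edges off \<open>C\<close> with first coordinate 1. Since all switched flows are
  balanced as well, the word can be cancelled arc by arc, and so the product is the identity.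

  A Kempe switch in the first coordinate exchanges the two shears along an arc. As the total
  product stays the identity, the product \<open>Z\<close> over the arc is invariant under this exchange; being
  unimodular, \<open>Z\<close> is \<open>\<plusminus>1\<close>. Choose a shortest arc between two changes of the second coordinate in
  one component. Combining its switch with one that starts inside it shows that the product
  over its first segment, where the second coordinate is constant, is invariant up to sign, which is
  impossible for a nonempty product of shears with entries of one sign.
\<close>

section \<open>Closed walks and their even edge sets\<close>

declare add_bit_eq_xor [simp del] mult_bit_eq_and [simp del]

lemma bit_add_self [simp]: "x + x = (0 :: bit)"
  by (cases x) simp_all

lemma bit_add_eq_0_iff: "x + y = 0 \<longleftrightarrow> x = (y :: bit)"
  by (cases x; cases y) simp_all

lemma sum_bit_telescope:
  fixes a :: "nat \<Rightarrow> bit"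
  assumes "k \<le> l"
  shows "(\<Sum>m = k..<l. a m + a (Suc m)) = a k + a l"
  using assms by (induction l rule: dec_induct) (simp_all add: ac_simps)

text \<open>Labels \<open>c 0, \<dots>, c n = c 0\<close> describe a closed walk whose \<open>m\<close>-th edge joins \<open>c m\<close> to \<open>c (m + 1)\<close>;
  \<open>j\<close> is admissible iff it is the indicator of an edge set with all degrees even.\<close>

definition pairing :: "nat \<Rightarrow> (nat \<Rightarrow> 'c) \<Rightarrow> (nat \<Rightarrow> bit) \<Rightarrow> ('c \<Rightarrow> bit) \<Rightarrow> bit" where
  "pairing n c j \<rho> = (\<Sum>m<n. j m * (\<rho> (c m) + \<rho> (c (Suc m))))"

definition admissible :: "nat \<Rightarrow> (nat \<Rightarrow> 'c) \<Rightarrow> (nat \<Rightarrow> bit) \<Rightarrow> bool" where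
  "admissible n c j \<longleftrightarrow> (\<forall>\<rho>. pairing n c j \<rho> = 0)"

lemma pairing_add: "pairing n c (\<lambda>m. j m + j' m) \<rho> = pairing n c j \<rho> + pairing n c j' \<rho>"
  by (simp add: pairing_def algebra_simps sum.distrib)

lemma pairing_add_right:
  "pairing n c j (\<lambda>x. \<rho> x + \<rho>' x) = pairing n c j \<rho> + pairing n c j \<rho>'"
  by (simp add: pairing_def algebra_simps sum.distrib)

lemma admissible_add:
  "admissible n c j \<Longrightarrow> admissible n c j' \<Longrightarrow> admissible n c (\<lambda>m. j m + j' m)"
  by (simp add: admissible_def pairing_add)

section \<open>Arcs of a closed walk, and changes of a bit sequence along it\<close>

definition interval_ind :: "nat \<Rightarrow> nat \<Rightarrow> nat \<Rightarrow> bit" where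
  "interval_ind k l m = of_bool (k \<le> m \<and> m < l)"

lemma pairing_interval_ind:
  assumes "k \<le> l" "l \<le> n"
  shows "pairing n c (interval_ind k l) \<rho> = \<rho> (c k) + \<rho> (c l)"
proof -
  have "pairing n c (interval_ind k l) \<rho> = (\<Sum>m = k..<l. \<rho> (c m) + \<rho> (c (Suc m)))"
    unfolding pairing_def interval_ind_def using assms
    by (intro sum.mono_neutral_cong_right) auto
  then show ?thesis using sum_bit_telescope[OF assms(1), of "\<lambda>m. \<rho> (c m)"] by simp
qed

lemma admissible_interval_ind:
  "k \<le> l \<Longrightarrow> l \<le> n \<Longrightarrow> c k = c l \<Longrightarrow> admissible n c (interval_ind k l)"
  by (simp add: admissible_def pairing_interval_ind)

definition cpred :: "nat \<Rightarrow> nat \<Rightarrow> nat" where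
  "cpred n k = (if k = 0 then n - 1 else k - 1)"

text \<open>Summation by parts around the walk: each vertex collects the two edges that meet there.
  The walk closes up, so \<open>cpred\<close> can send index 0 to the last edge.\<close>

lemma pairing_by_parts:
  assumes "c n = c 0"
  shows "pairing n c j \<rho> = (\<Sum>k<n. \<rho> (c k) * (j k + j (cpred n k)))"
proof (cases n)
  case 0
  then show ?thesis by (simp add: pairing_def)
next
  case (Suc N)
  have "(\<Sum>m<n. j m * \<rho> (c (Suc m))) = (\<Sum>k<N. j k * \<rho> (c (Suc k))) + j N * \<rho> (c 0)"
    using assms by (simp add: Suc)
  also have "\<dots> = (\<Sum>k<n. \<rho> (c k) * j (cpred n k))"
    unfolding Suc sum.lessThan_Suc_shift by (simp add: cpred_def ac_simps)
  finally show ?thesis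
    by (simp add: pairing_def algebra_simps sum.distrib)
qed

definition changes :: "nat \<Rightarrow> (nat \<Rightarrow> bit) \<Rightarrow> nat set" where
  "changes n t = {k. k < n \<and> t k \<noteq> t (cpred n k)}"

text \<open>Testing \<open>t\<close> against the indicator of the label \<open>c k\<close> counts
  the changes at that label modulo 2. Admissibility makes the count even, so \<open>k\<close> is not
  alone.\<close>

lemma admissible_changes_paired:
  assumes "admissible n c t" "c n = c 0" "k \<in> changes n t"
  obtains l where "l \<in> changes n t" "l \<noteq> k" "c l = c k"
proof -
  let ?f = "\<lambda>m. of_bool (c m = c k) * (t m + t (cpred n m))"
  have "sum ?f {..<n} = 0"
    using assms(1) pairing_by_parts[OF assms(2), of t "\<lambda>x. of_bool (x = c k)"]
    by (simp add: admissible_def)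
  moreover have "k < n" "?f k = 1"
    using assms(3) by (auto simp: changes_def bit_add_eq_0_iff simp flip: bit_not_zero_iff)
  ultimately have "sum ?f ({..<n} - {k}) = 1"
    by (subst (asm) sum.remove[of _ k]) (auto simp: bit_add_eq_0_iff)
  then obtain l where "l \<in> {..<n} - {k}" "?f l \<noteq> 0"
    by (metis (no_types, lifting) sum.neutral zero_neq_one)
  then show thesis
    by (intro that[of l]) (auto simp: changes_def)
qed

text \<open>Take \<open>k\<close>, \<open>l\<close> at minimal distance among pairs with equal
  labels, and let \<open>q\<close> be the next element of \<open>K\<close> after \<open>k\<close>.
  If \<open>q\<close> is not \<open>l\<close>, a partner of \<open>q\<close> between
  \<open>k\<close> and \<open>l\<close> would give a closer pair; so the partner lies outside, and
  the two pairs cross.\<close>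

lemma closest_pair:
  fixes K :: "nat set"
  assumes "\<And>k. k \<in> K \<Longrightarrow> \<exists>l \<in> K. l \<noteq> k \<and> c l = c k" "K \<noteq> {}"
  shows "\<exists>k \<in> K. \<exists>q \<in> K. \<exists>l \<in> K. k < q \<and> q \<le> l \<and> c k = c l \<and>
    (\<forall>m. k < m \<longrightarrow> m < q \<longrightarrow> m \<notin> K) \<and>
    (q = l \<or> (\<exists>r \<in> K. c r = c q \<and> (r < k \<or> l < r)))"
proof -
  define Q where "Q d \<longleftrightarrow> (\<exists>k \<in> K. \<exists>l \<in> K. k < l \<and> c k = c l \<and> d = l - k)" for d
  have "\<exists>d. Q d"
  proof -
    obtain k where "k \<in> K" using assms(2) by auto
    then obtain l where "l \<in> K" "l \<noteq> k" "c l = c k" using assms(1) by blast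
    then show ?thesis using \<open>k \<in> K\<close> unfolding Q_def
      by (metis linorder_neqE_nat)
  qed
  then have "Q (LEAST d. Q d)" by (metis LeastI)
  then obtain k l where kl: "k \<in> K" "l \<in> K" "k < l" "c k = c l" "(LEAST d. Q d) = l - k"
    unfolding Q_def by auto
  have min: "l - k \<le> l' - k'" if "k' \<in> K" "l' \<in> K" "k' < l'" "c k' = c l'" for k' l'
    using that kl(5) Least_le[of Q "l' - k'"] unfolding Q_def by auto
  define q where "q = (LEAST q. q \<in> K \<and> k < q)"
  have q: "q \<in> K" "k < q" unfolding q_def
    using LeastI[of "\<lambda>q. q \<in> K \<and> k < q" l] kl by auto
  have ql: "q \<le> l" unfolding q_def using kl by (intro Least_le) auto
  have qm: "m \<notin> K" if "k < m" "m < q" for m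
    using that not_less_Least[of m "\<lambda>q. q \<in> K \<and> k < q"] unfolding q_def by auto
  have "q = l \<or> (\<exists>r \<in> K. c r = c q \<and> (r < k \<or> l < r))"
  proof (rule disjCI)
    assume no: "\<not> (\<exists>r \<in> K. c r = c q \<and> (r < k \<or> l < r))"
    obtain r where r: "r \<in> K" "r \<noteq> q" "c r = c q" using assms(1)[OF q(1)] by auto
    have "k \<le> r" "r \<le> l" using no r by force+
    then show "q = l"
    proof (cases "r < q")
      case True
      then show ?thesis using min[of r q] q r \<open>k \<le> r\<close> ql by linarith
    next
      case False
      then have "q < r" using r(2) by simp
      then show ?thesis using min[of q r] q r \<open>r \<le> l\<close> by auto
    qed
  qed
  then show ?thesis using kl q ql qm by blast
qed

section \<open>Weights of even edge sets\<close>

definition wsum :: "nat \<Rightarrow> (nat \<Rightarrow> bit) \<Rightarrow> (nat \<Rightarrow> int) \<Rightarrow> bit \<Rightarrow> (nat \<Rightarrow> bit) \<Rightarrow> int" where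
  "wsum n t s b j = (\<Sum>m<n. of_bool (j m = 1 \<and> t m = b) * s m)"

lemma wsum_interval_ind:
  assumes "l \<le> n"
  shows "wsum n t s b (interval_ind k l) = (\<Sum>m = k..<l. of_bool (t m = b) * s m)"
  unfolding wsum_def interval_ind_def using assms
  by (intro sum.mono_neutral_cong_right) auto

text \<open>Inclusion-exclusion: addition of bits is symmetric difference, multiplication is
  intersection.\<close>

lemma wsum_add:
  "wsum n t s b (\<lambda>m. j m + j' m) =
    wsum n t s b j + wsum n t s b j' - 2 * wsum n t s b (\<lambda>m. j m * j' m)"
proof -
  have *: "of_bool (x + y = 1 \<and> P) * z =
    of_bool (x = 1 \<and> P) * z + of_bool (y = 1 \<and> P) * z - 2 * (of_bool (x * y = 1 \<and> P) * z)"
    for x y :: bit and P and z :: int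
    by (cases x; cases y) simp_all
  show ?thesis
    unfolding wsum_def * sum_subtractf sum.distrib sum_distrib_left ..
qed

section \<open>Deletion of an arc and identification of its two end labels\<close>

definition skip :: "nat \<Rightarrow> nat \<Rightarrow> nat \<Rightarrow> nat" where
  "skip k d m = (if m < k then m else m + d)"

definition glue :: "'c \<Rightarrow> 'c \<Rightarrow> 'c \<Rightarrow> 'c" where
  "glue a b x = (if x = a then b else x)"

lemma sum_split3:
  fixes f :: "nat \<Rightarrow> 'a::comm_monoid_add"
  assumes "k \<le> q" "q \<le> n"
  shows "(\<Sum>m<n. f m) = (\<Sum>m<k. f m) + (\<Sum>m = k..<q. f m) + (\<Sum>m = q..<n. f m)"
  using assms
  by (simp add: lessThan_atLeast0 sum.atLeastLessThan_concat)

lemma sum_skip: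
  fixes f :: "nat \<Rightarrow> 'a::comm_monoid_add"
  assumes "k \<le> q" "q \<le> n"
  shows "(\<Sum>m<n - (q - k). f (skip k (q - k) m)) = (\<Sum>m<k. f m) + (\<Sum>m = q..<n. f m)"
proof -
  have "(\<Sum>m<n - (q - k). f (skip k (q - k) m)) =
    (\<Sum>m<k. f (skip k (q - k) m)) + (\<Sum>m = k..<n - (q - k). f (skip k (q - k) m))"
    using assms by (simp add: lessThan_atLeast0 sum.atLeastLessThan_concat)
  also have "(\<Sum>m = k..<n - (q - k). f (skip k (q - k) m)) =
      (\<Sum>m = k..<n - (q - k). f (m + (q - k)))"
    by (simp add: skip_def)
  also have "\<dots> = (\<Sum>m = k + (q - k)..<n - (q - k) + (q - k). f m)"
    by (rule sum.shift_bounds_nat_ivl [symmetric])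
  also have "\<dots> = (\<Sum>m = q..<n. f m)"
    using assms by simp
  finally show ?thesis by (simp add: skip_def)
qed

text \<open>Test functions that factor through the gluing agree at \<open>c k\<close> and
  \<open>c q\<close>. Against them the deleted arc, on which \<open>j\<close> is constant,
  telescopes to zero.\<close>

lemma pairing_skip:
  assumes "k < q" "q \<le> n" "\<And>m. k \<le> m \<Longrightarrow> m < q \<Longrightarrow> j m = \<beta>"
  shows "pairing (n - (q - k)) (glue (c k) (c q) \<circ> c \<circ> skip k (q - k)) (j \<circ> skip k (q - k)) \<rho>
    = pairing n c j (\<rho> \<circ> glue (c k) (c q))"
proof -
  let ?\<sigma> = "skip k (q - k)" and ?\<rho> = "\<rho> \<circ> glue (c k) (c q)"
  have kq: "?\<rho> (c k) = ?\<rho> (c q)" by (simp add: glue_def)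
  \<comment> \<open>Only \<open>Suc m = k\<close> matters: there the two sides carry the labels of
    \<open>q\<close> and of \<open>k\<close>, which are glued.\<close>
  have suc: "?\<rho> (c (?\<sigma> (Suc m))) = ?\<rho> (c (Suc (?\<sigma> m)))" for m
    using kq assms(1) by (cases "Suc m = k") (auto simp: skip_def)
  have "(\<Sum>m = k..<q. j m * (?\<rho> (c m) + ?\<rho> (c (Suc m)))) =
    (\<Sum>m = k..<q. \<beta> * (?\<rho> (c m) + ?\<rho> (c (Suc m))))"
    using assms(3) by (intro sum.cong) auto
  also have "\<dots> = \<beta> * (?\<rho> (c k) + ?\<rho> (c q))"
    using sum_bit_telescope[of k q "\<lambda>m. ?\<rho> (c m)"] assms(1) by (simp flip: sum_distrib_left)
  also have "\<dots> = 0" using kq by simp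
  finally have mid: "(\<Sum>m = k..<q. j m * (?\<rho> (c m) + ?\<rho> (c (Suc m)))) = 0" .
  have "pairing (n - (q - k)) (glue (c k) (c q) \<circ> c \<circ> ?\<sigma>) (j \<circ> ?\<sigma>) \<rho> =
    (\<Sum>m<n - (q - k). j (?\<sigma> m) * (?\<rho> (c (?\<sigma> m)) + ?\<rho> (c (Suc (?\<sigma> m)))))"
    unfolding pairing_def suc[symmetric] by simp
  also have "\<dots> = pairing n c j ?\<rho>"
    unfolding pairing_def
    using sum_skip[of k q n "\<lambda>m. j m * (?\<rho> (c m) + ?\<rho> (c (Suc m)))"]
      sum_split3[of k q n "\<lambda>m. j m * (?\<rho> (c m) + ?\<rho> (c (Suc m)))"] mid assms by simp
  finally show ?thesis .
qed

lemma admissible_skip: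
  assumes "k < q" "q \<le> n" "\<And>m. k \<le> m \<Longrightarrow> m < q \<Longrightarrow> j m = \<beta>" "admissible n c j"
  shows "admissible (n - (q - k)) (glue (c k) (c q) \<circ> c \<circ> skip k (q - k)) (j \<circ> skip k (q - k))"
  using assms(4) pairing_skip[OF assms(1,2), of j \<beta> c] assms(3) by (simp add: admissible_def)

definition unskip :: "nat \<Rightarrow> nat \<Rightarrow> bit \<Rightarrow> (nat \<Rightarrow> bit) \<Rightarrow> nat \<Rightarrow> bit" where
  "unskip k q \<beta> j m = (if m < k then j m else if m < q then \<beta> else j (m - (q - k)))"

lemma unskip_skip: "k < q \<Longrightarrow> unskip k q \<beta> j \<circ> skip k (q - k) = j"
  by (rule ext) (auto simp: unskip_def skip_def)

text \<open>The value on the removed arc is the freedom that absorbs the gluing of the two labels.\<close>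

lemma admissible_unskip:
  assumes "k < q" "q \<le> n"
    and adm: "admissible (n - (q - k)) (glue (c k) (c q) \<circ> c \<circ> skip k (q - k)) j"
  obtains \<beta> where "admissible n c (unskip k q \<beta> j)"
proof -
  define \<delta> :: "_ \<Rightarrow> bit" where "\<delta> x = of_bool (x = c k)" for x
  \<comment> \<open>The defect of the extension by 0 against the indicator of \<open>c k\<close>.
    When the two end labels differ, adding the arc with coefficient \<open>\<beta>\<close> changes
    the pairing by exactly this amount.\<close>
  define \<beta> where "\<beta> = pairing n c (unskip k q 0 j) \<delta>"
  have glued: "pairing n c (unskip k q \<beta> j) (\<rho> \<circ> glue (c k) (c q)) = 0" for \<rho>
    using pairing_skip[OF assms(1,2), of "unskip k q \<beta> j" \<beta> c \<rho>] adm unskip_skip[OF assms(1)]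
    by (simp add: admissible_def unskip_def)
  have "pairing n c (unskip k q \<beta> j) \<rho> = 0" for \<rho>
  proof (cases "\<rho> (c k) = \<rho> (c q)")
    case True
    then have "\<rho> \<circ> glue (c k) (c q) = \<rho>" by (auto simp: glue_def)
    with glued[of \<rho>] show ?thesis by simp
  next
    case False
    then have ne: "c k \<noteq> c q" by auto
    have "unskip k q \<beta> j = (\<lambda>m. unskip k q 0 j m + \<beta> * interval_ind k q m)"
      using assms(1) by (auto simp: unskip_def interval_ind_def)
    then have "pairing n c (unskip k q \<beta> j) \<delta> =
        \<beta> + \<beta> * pairing n c (interval_ind k q) \<delta>"
      by (simp add: \<beta>_def pairing_add) (simp add: pairing_def sum_distrib_left mult.assoc)
    also have "\<dots> = 0"
      using ne assms(1,2) by (simp add: pairing_interval_ind \<delta>_def)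
    finally have d0: "pairing n c (unskip k q \<beta> j) \<delta> = 0" .
    \<comment> \<open>Up to functions that factor through the gluing, \<open>\<delta>\<close> is the
      only further test function.\<close>
    have "\<rho> = (\<lambda>x. (\<rho> \<circ> glue (c k) (c q)) x + \<delta> x)"
    proof
      show "\<rho> x = (\<rho> \<circ> glue (c k) (c q)) x + \<delta> x" for x
        using False by (cases "\<rho> (c k)"; cases "\<rho> (c q)") (simp_all add: glue_def \<delta>_def)
    qed
    then have "pairing n c (unskip k q \<beta> j) \<rho> =
      pairing n c (unskip k q \<beta> j) (\<rho> \<circ> glue (c k) (c q)) + pairing n c (unskip k q \<beta> j) \<delta>"
      using pairing_add_right[of n c "unskip k q \<beta> j" "\<rho> \<circ> glue (c k) (c q)" \<delta>] by simp
    then show ?thesis using glued d0 by simp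
  qed
  then show thesis using that[of \<beta>] by (simp add: admissible_def)
qed

text \<open>An intersection of admissible sets need not be admissible. It still has weight 0,
  because both sets and their symmetric difference do.\<close>

lemma wsum_inter:
  assumes zero: "\<And>j. admissible n c j \<Longrightarrow> wsum n t s b j = 0"
    and "admissible n c j" "admissible n c j'"
  shows "wsum n t s b (\<lambda>m. j m * j' m) = 0"
  using wsum_add[of n t s b j j'] zero[OF assms(2)] zero[OF assms(3)]
    zero[OF admissible_add[OF assms(2,3)]] by simp

lemma constant_between_changes:
  assumes "q \<le> n" "\<And>m. k < m \<Longrightarrow> m < q \<Longrightarrow> m \<notin> changes n t" "k \<le> m" "m < q"
  shows "t m = t k"
  using assms(3,4)
proof (induction m rule: dec_induct)
  case (step m)
  then have "Suc m \<notin> changes n t" using assms(2)[of "Suc m"] by simp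
  then show ?case using step assms(1) by (simp add: changes_def cpred_def)
qed simp

lemma changes_closest_pair:
  assumes "admissible n c t" "c n = c 0" "changes n t \<noteq> {}"
  obtains k q l where "k < q" "q \<le> l" "l < n" "c k = c l"
    "\<And>m. k \<le> m \<Longrightarrow> m < q \<Longrightarrow> t m = t k"
    "q = l \<or> (\<exists>r<n. c r = c q \<and> (r < k \<or> l < r))"
proof -
  have "\<exists>l \<in> changes n t. l \<noteq> k \<and> c l = c k" if "k \<in> changes n t" for k
    by (rule admissible_changes_paired[OF assms(1,2) that]) blast
  from closest_pair[OF this assms(3)] obtain k q l where
    K: "l \<in> changes n t" "k < q" "q \<le> l" "c k = c l"
    and gap: "\<And>m. k < m \<Longrightarrow> m < q \<Longrightarrow> m \<notin> changes n t"
    and r: "q = l \<or> (\<exists>r \<in> changes n t. c r = c q \<and> (r < k \<or> l < r))"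
    by blast
  have l: "l < n" using K(1) by (simp add: changes_def)
  then have "t m = t k" if "k \<le> m" "m < q" for m
    using constant_between_changes[OF _ gap that] K(3) by simp
  moreover have "q = l \<or> (\<exists>r<n. c r = c q \<and> (r < k \<or> l < r))"
    using r by (auto simp: changes_def)
  ultimately show thesis using that[OF K(2,3) l K(4)] by blast
qed

section \<open>Cancellation of words along a closed walk\<close>

lemma prod_list_hom:
  fixes h :: "int \<Rightarrow> 'm::monoid_mult"
  assumes "h 0 = 1" "\<And>x y. h (x + y) = h x * h y"
  shows "prod_list (map (\<lambda>m. h (s m)) xs) = h (\<Sum>m\<leftarrow>xs. s m)"
  using assms by (induction xs) simp_all

lemma prod_list_arc:
  fixes h :: "bit \<Rightarrow> int \<Rightarrow> 'm::monoid_mult"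
  assumes "\<And>b. h b 0 = 1" "\<And>b x y. h b (x + y) = h b x * h b y"
    and "\<And>m. k \<le> m \<Longrightarrow> m < q \<Longrightarrow> t m = b" "(\<Sum>m = k..<q. s m) = 0"
  shows "prod_list (map (\<lambda>m. h (t m) (s m)) [k..<q]) = 1"
proof -
  have "map (\<lambda>m. h (t m) (s m)) [k..<q] = map (\<lambda>m. h b (s m)) [k..<q]"
    using assms(3) by (intro map_cong) auto
  also have "prod_list \<dots> = h b (\<Sum>m\<leftarrow>[k..<q]. s m)"
    using assms(1,2) by (rule prod_list_hom)
  also have "(\<Sum>m\<leftarrow>[k..<q]. s m) = 0"
    using assms(4) by (simp add: interv_sum_list_conv_sum_set_nat)
  finally show ?thesis using assms(1) by simp
qed

text \<open>If \<open>q\<close> is not \<open>l\<close>, the arc between \<open>q\<close> and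
  \<open>r\<close> crosses the one from \<open>k\<close> to \<open>l\<close>. They meet in
  \<open>[k, q)\<close> or in \<open>[q, l)\<close>, whose weight \<open>wsum_inter\<close> gives;
  in the second case it is subtracted from the weight of \<open>[k, l)\<close>.\<close>

lemma arc_sum_zero:
  assumes zero: "\<And>j. admissible n c j \<Longrightarrow> wsum n t s b j = 0"
    and "k < q" "q \<le> l" "l < n" "c k = c l"
    and r: "q = l \<or> (\<exists>r<n. c r = c q \<and> (r < k \<or> l < r))"
  shows "(\<Sum>m = k..<q. of_bool (t m = b) * s m) = 0"
proof -
  let ?F = "\<lambda>x y. \<Sum>m = x..<y. of_bool (t m = b) * s m"
  have adm: "admissible n c (interval_ind k l)"
    using assms by (intro admissible_interval_ind) auto
  have F: "?F k l = 0"
    using zero[OF adm] assms by (simp add: wsum_interval_ind)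
  show ?thesis
  proof (cases "q = l")
    case True
    then show ?thesis using F by simp
  next
    case False
    then obtain r where r: "r < n" "c r = c q" "r < k \<or> l < r" using r by auto
    show ?thesis
    proof (cases "r < k")
      case True
      have "admissible n c (interval_ind r q)"
        using True assms r by (intro admissible_interval_ind) auto
      from wsum_inter[OF zero adm this]
      have "wsum n t s b (\<lambda>m. interval_ind k l m * interval_ind r q m) = 0" .
      moreover have "(\<lambda>m. interval_ind k l m * interval_ind r q m) = interval_ind k q"
        using True assms by (auto simp: interval_ind_def fun_eq_iff)
      ultimately show ?thesis using assms by (simp add: wsum_interval_ind)
    next
      case False
      then have "l < r" using r by simp
      then have "admissible n c (interval_ind q r)"
        using assms r by (intro admissible_interval_ind) auto
      from wsum_inter[OF zero adm this]
      have "wsum n t s b (\<lambda>m. interval_ind k l m * interval_ind q r m) = 0" .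
      moreover have "(\<lambda>m. interval_ind k l m * interval_ind q r m) = interval_ind q l"
        using \<open>l < r\<close> assms by (auto simp: interval_ind_def fun_eq_iff)
      ultimately have "?F q l = 0" using assms by (simp add: wsum_interval_ind)
      then show ?thesis
        using F sum.atLeastLessThan_concat[of k q l "\<lambda>m. of_bool (t m = b) * s m"] assms by simp
    qed
  qed
qed

lemma upt_split: "i \<le> j \<Longrightarrow> j \<le> k \<Longrightarrow> [i..<k] = [i..<j] @ [j..<k]"
  using upt_add_eq_append[of i j "k - j"] by simp

lemma map_skip_upt:
  assumes "k < q" "q \<le> n"
  shows "map (skip k (q - k)) [0..<n - (q - k)] = [0..<k] @ [q..<n]"
proof (rule nth_equalityI)
  show "length (map (skip k (q - k)) [0..<n - (q - k)]) = length ([0..<k] @ [q..<n])"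
    using assms by auto
  show "map (skip k (q - k)) [0..<n - (q - k)] ! i = ([0..<k] @ [q..<n]) ! i"
    if "i < length (map (skip k (q - k)) [0..<n - (q - k)])" for i
    using that assms by (auto simp: nth_append skip_def)
qed

text \<open>Induction on the length. A suitable arc on which \<open>t\<close> is constant has sum 0,
  so its letters multiply to 1 and it can be deleted; the hypotheses survive on the shorter walk
  with glued labels.\<close>

lemma closed_walk_product_trivial:
  fixes h :: "bit \<Rightarrow> int \<Rightarrow> 'm::monoid_mult"
  assumes h: "\<And>b. h b 0 = 1" "\<And>b x y. h b (x + y) = h b x * h b y"
    and "c n = c 0" "admissible n c t"
    and "\<And>j b. admissible n c j \<Longrightarrow> wsum n t s b j = 0"
  shows "prod_list (map (\<lambda>m. h (t m) (s m)) [0..<n]) = 1"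
  using assms(3-5)
proof (induction n arbitrary: c t s rule: less_induct)
  case (less n)
  note zero = less.prems(3)
  show ?case
  proof (cases "changes n t = {}")
    case True
    then have const: "t m = t 0" if "m < n" for m
      using constant_between_changes[of n n 0 t m] that by simp
    \<comment> \<open>The whole closed walk is admissible, so the total of \<open>s\<close>
      vanishes.\<close>
    have "wsum n t s (t 0) (interval_ind 0 n) = 0"
      using less.prems(1) by (intro zero admissible_interval_ind) auto
    then have "(\<Sum>m = 0..<n. of_bool (t m = t 0) * s m) = 0"
      by (simp add: wsum_interval_ind)
    moreover have "(\<Sum>m = 0..<n. of_bool (t m = t 0) * s m) = (\<Sum>m = 0..<n. s m)"
    proof (rule sum.cong[OF refl])
      show "of_bool (t m = t 0) * s m = s m" if "m \<in> {0..<n}" for m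
        using const[of m] that by simp
    qed
    ultimately have "(\<Sum>m = 0..<n. s m) = 0" by metis
    then show ?thesis by (intro prod_list_arc[OF h, where b = "t 0"] const)
  next
    case False
    obtain k q l where K: "k < q" "q \<le> l" "l < n" "c k = c l"
      and const: "\<And>m. k \<le> m \<Longrightarrow> m < q \<Longrightarrow> t m = t k"
      and r: "q = l \<or> (\<exists>r<n. c r = c q \<and> (r < k \<or> l < r))"
      using changes_closest_pair[OF less.prems(2,1) False] by blast
    have lt: "q < n" "q \<le> n" using K by auto
    from K r have "(\<Sum>m = k..<q. of_bool (t m = t k) * s m) = 0"
      by (intro arc_sum_zero[of n c t s "t k" k q l]) (auto intro: zero)
    moreover have "(\<Sum>m = k..<q. of_bool (t m = t k) * s m) = (\<Sum>m = k..<q. s m)"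
    proof (rule sum.cong[OF refl])
      show "of_bool (t m = t k) * s m = s m" if "m \<in> {k..<q}" for m
        using const[of m] that by simp
    qed
    ultimately have arc: "(\<Sum>m = k..<q. s m) = 0" by simp
    let ?\<sigma> = "skip k (q - k)" and ?n = "n - (q - k)"
    let ?c = "glue (c k) (c q) \<circ> c \<circ> ?\<sigma>"
    have "prod_list (map (\<lambda>m. h ((t \<circ> ?\<sigma>) m) ((s \<circ> ?\<sigma>) m)) [0..<?n]) = 1"
    proof (rule less.IH)
      show "?n < n" using K(1) lt by simp
      show "?c ?n = ?c 0"
        using less.prems(1) K(1) lt by (auto simp: skip_def glue_def)
      show "admissible ?n ?c (t \<circ> ?\<sigma>)"
        by (rule admissible_skip[OF K(1) lt(2) const less.prems(2)])
      \<comment> \<open>An admissible set on the shorter walk lifts with some constant value on the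
        deleted arc. The arc sums to 0, so that value does not affect the weight.\<close>
      show "wsum ?n (t \<circ> ?\<sigma>) (s \<circ> ?\<sigma>) b j = 0" if j: "admissible ?n ?c j" for j b
      proof -
        from admissible_unskip[OF K(1) lt(2) j]
        obtain \<beta> where "admissible n c (unskip k q \<beta> j)" .
        then have "wsum n t s b (unskip k q \<beta> j) = 0" by (rule zero)
        moreover have "(\<Sum>m = k..<q. of_bool (unskip k q \<beta> j m = 1 \<and> t m = b) * s m) =
          (\<Sum>m = k..<q. of_bool (\<beta> = 1 \<and> t k = b) * s m)"
        proof (rule sum.cong[OF refl])
          show "of_bool (unskip k q \<beta> j m = 1 \<and> t m = b) * s m =
            of_bool (\<beta> = 1 \<and> t k = b) * s m" if "m \<in> {k..<q}" for m
            using const[of m] that by (simp add: unskip_def)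
        qed
        moreover have "\<dots> = 0" using arc by (simp flip: sum_distrib_left)
        moreover have "j = unskip k q \<beta> j \<circ> ?\<sigma>" using unskip_skip[OF K(1)] by simp
        ultimately show ?thesis
          using sum_split3[of k q n "\<lambda>m. of_bool (unskip k q \<beta> j m = 1 \<and> t m = b) * s m"]
            sum_skip[of k q n "\<lambda>m. of_bool (unskip k q \<beta> j m = 1 \<and> t m = b) * s m"] K(1) lt
          by (simp add: wsum_def fun_eq_iff)
      qed
    qed
    then have "prod_list (map (\<lambda>m. h (t m) (s m)) (map ?\<sigma> [0..<?n])) = 1"
      by (simp add: comp_def)
    then have "prod_list (map (\<lambda>m. h (t m) (s m)) [0..<k]) *
        prod_list (map (\<lambda>m. h (t m) (s m)) [q..<n]) = 1"
      using map_skip_upt[OF K(1) lt(2)] by simp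
    moreover have "prod_list (map (\<lambda>m. h (t m) (s m)) [k..<q]) = 1"
      by (rule prod_list_arc[OF h const arc])
    moreover have "[0..<n] = [0..<k] @ [k..<q] @ [q..<n]"
      using K(1) lt upt_split[of 0 k n] upt_split[of k q n] by simp
    ultimately show ?thesis by simp
  qed
qed

section \<open>Unimodular integer matrices\<close>

datatype mat2 = Mat2 int int int int

instantiation mat2 :: monoid_mult
begin

definition one_mat2 :: mat2 where
  "1 = Mat2 1 0 0 1"

fun times_mat2 :: "mat2 \<Rightarrow> mat2 \<Rightarrow> mat2" where
  "Mat2 a b c d * Mat2 a' b' c' d' =
    Mat2 (a * a' + b * c') (a * b' + b * d') (c * a' + d * c') (c * b' + d * d')"

instance
proof
  show "A * B * C = A * (B * C)" for A B C :: mat2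
    by (cases A; cases B; cases C) (simp add: algebra_simps)
  show "1 * A = A" "A * 1 = A" for A :: mat2
    by (cases A; simp add: one_mat2_def)+
qed

end

fun det2 :: "mat2 \<Rightarrow> int" where
  "det2 (Mat2 a b c d) = a * d - b * c"

fun adj2 :: "mat2 \<Rightarrow> mat2" where
  "adj2 (Mat2 a b c d) = Mat2 d (- b) (- c) a"

text \<open>Conjugation by the permutation matrix that exchanges the two coordinates.\<close>

fun flip2 :: "mat2 \<Rightarrow> mat2" where
  "flip2 (Mat2 a b c d) = Mat2 d c b a"

definition shear :: "bit \<Rightarrow> int \<Rightarrow> mat2" where
  "shear b s = (if b = 0 then Mat2 1 s 0 1 else Mat2 1 0 s 1)"

lemma det2_mult: "det2 (A * B) = det2 A * det2 B"
  by (cases A; cases B) (simp add: algebra_simps)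

lemma adj2_mult_left: "det2 A = 1 \<Longrightarrow> adj2 A * A = 1"
  by (cases A) (simp add: one_mat2_def algebra_simps)

lemma adj2_mult_right: "det2 A = 1 \<Longrightarrow> A * adj2 A = 1"
  by (cases A) (simp add: one_mat2_def algebra_simps)

lemma flip2_mult: "flip2 (A * B) = flip2 A * flip2 B"
  by (cases A; cases B) (simp add: algebra_simps)

lemma flip2_flip2 [simp]: "flip2 (flip2 A) = A"
  by (cases A) simp

lemma flip2_one [simp]: "flip2 1 = 1"
  by (simp add: one_mat2_def)

lemma det2_one [simp]: "det2 1 = 1"
  by (simp add: one_mat2_def)

lemma shear_0: "shear b 0 = 1"
  by (simp add: shear_def one_mat2_def)

lemma shear_add: "shear b (x + y) = shear b x * shear b y"
  by (simp add: shear_def)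

lemma flip2_shear: "flip2 (shear b s) = shear (b + 1) s"
  by (cases b) (simp_all add: shear_def)

lemma det2_prod_shear: "det2 (prod_list (map (\<lambda>m. shear (b m) (s m)) xs)) = 1"
  by (induction xs) (simp_all add: det2_mult shear_def)

lemma flip2_prod_shear:
  "flip2 (prod_list (map (\<lambda>m. shear (b m) (s m)) xs)) =
    prod_list (map (\<lambda>m. shear (b m + 1) (s m)) xs)"
  by (induction xs) (simp_all add: flip2_mult flip2_shear)

lemma mult_cancel_middle:
  assumes "A * Z * B = 1" "A * Z' * B = 1" "det2 A = 1" "det2 B = 1"
  shows "Z = Z'"
proof -
  have "Y = adj2 A * adj2 B" if "A * Y * B = 1" for Y
  proof -
    have "Y = (adj2 A * A) * Y * (B * adj2 B)"
      using assms by (simp add: adj2_mult_left adj2_mult_right)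
    also have "\<dots> = adj2 A * (A * Y * B) * adj2 B" by (simp only: mult.assoc)
    finally show ?thesis using that by simp
  qed
  then show ?thesis using assms by metis
qed

text \<open>A fixed matrix has rows \<open>(x, y)\<close> and \<open>(y, x)\<close>, so its
  determinant is \<open>(x - y) * (x + y)\<close>. Over the integers both factors are 1 or both are
  -1.\<close>

lemma flip2_fixed_unimodular:
  assumes "flip2 Z = Z" "det2 Z = 1"
  shows "Z = 1 \<or> Z = Mat2 (- 1) 0 0 (- 1)"
proof -
  obtain x y z u where Z: "Z = Mat2 x y z u" by (cases Z)
  then have "u = x" "z = y" using assms(1) unfolding Z flip2.simps mat2.inject by blast+
  moreover have "x * u - y * z = 1" using assms(2) Z by simp
  ultimately have "(x - y) * (x + y) = 1" by (simp only: left_diff_distrib distrib_left) simp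
  then have "(x - y = 1 \<and> x + y = 1) \<or> (x - y = -1 \<and> x + y = -1)"
    by (simp only: zmult_eq_1_iff)
  then have "y = 0 \<and> (x = 1 \<or> x = - 1)" by presburger
  then show ?thesis unfolding Z \<open>u = x\<close> \<open>z = y\<close> one_mat2_def by auto
qed

text \<open>Conjugation by the diagonal matrix with entries 1 and \<open>\<epsilon>\<close> makes
  all the shears positive, so \<open>\<epsilon>\<close> survives only off the diagonal. The last
  clause says that a nonempty product is not diagonal.\<close>

lemma prod_shear_same_sign:
  fixes w :: "nat \<Rightarrow> int"
  assumes "\<epsilon> * \<epsilon> = 1" "\<And>m. m \<in> set xs \<Longrightarrow> w m > 0"
  shows "\<exists>p q r t. prod_list (map (\<lambda>m. shear (b m) (\<epsilon> * w m)) xs) = Mat2 p (\<epsilon> * q) (\<epsilon> * r) t \<and>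
    p \<ge> 1 \<and> t \<ge> 1 \<and> q \<ge> 0 \<and> r \<ge> 0 \<and> (xs \<noteq> [] \<longrightarrow> q + r \<ge> 1)"
  using assms(2)
proof (induction xs)
  case Nil
  have "prod_list (map (\<lambda>m. shear (b m) (\<epsilon> * w m)) []) = Mat2 1 (\<epsilon> * 0) (\<epsilon> * 0) 1"
    by (simp add: one_mat2_def)
  moreover have "(1::int) \<ge> 1" "(0::int) \<ge> 0" by simp_all
  ultimately show ?case by blast
next
  case (Cons m xs)
  then obtain p q r t where P: "prod_list (map (\<lambda>m. shear (b m) (\<epsilon> * w m)) xs) = Mat2 p (\<epsilon> * q) (\<epsilon> * r) t"
    and pos: "p \<ge> 1" "t \<ge> 1" "q \<ge> 0" "r \<ge> 0" by auto
  have w: "w m > 0" using Cons.prems by simp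
  have sq: "\<epsilon> * w m * (\<epsilon> * z) = w m * z" for z
  proof -
    have "\<epsilon> * w m * (\<epsilon> * z) = (\<epsilon> * \<epsilon>) * (w m * z)" by (simp only: ac_simps)
    then show ?thesis using assms(1) by simp
  qed
  show ?case
  proof (cases "b m = 0")
    case True
    have "prod_list (map (\<lambda>m. shear (b m) (\<epsilon> * w m)) (m # xs)) =
      Mat2 (p + w m * r) (\<epsilon> * (q + w m * t)) (\<epsilon> * r) t"
      using P sq by (simp add: shear_def True algebra_simps)
    moreover have "w m * t \<ge> 1" "w m * r \<ge> 0"
      using w pos by (auto simp: int_one_le_iff_zero_less)
    then have "p + w m * r \<ge> 1" "q + w m * t \<ge> 0" "q + w m * t + r \<ge> 1"
      using pos by auto
    ultimately show ?thesis using pos by blast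
  next
    case False
    have "prod_list (map (\<lambda>m. shear (b m) (\<epsilon> * w m)) (m # xs)) =
      Mat2 p (\<epsilon> * q) (\<epsilon> * (r + w m * p)) (t + w m * q)"
      using P sq by (simp add: shear_def False algebra_simps)
    moreover have "w m * p \<ge> 1" "w m * q \<ge> 0"
      using w pos by (auto simp: int_one_le_iff_zero_less)
    then have "t + w m * q \<ge> 1" "r + w m * p \<ge> 0" "q + (r + w m * p) \<ge> 1"
      using pos by auto
    ultimately show ?thesis using pos by blast
  qed
qed

text \<open>Both products are 1 or -1. Hence \<open>U\<close> is the inverse of \<open>P\<close> up
  to sign, and \<open>P\<close> equals \<open>flip2 P\<close> up to sign. Positivity excludes the
  minus sign, and the determinant then forces \<open>P = 1\<close>, against
  \<open>q + r \<ge> 1\<close>.\<close>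

lemma same_sign_not_flip2_fixed:
  assumes P: "P = Mat2 p (\<epsilon> * q) (\<epsilon> * r) t" "\<epsilon> * \<epsilon> = 1" "p \<ge> 1" "t \<ge> 1" "q \<ge> 0" "r \<ge> 0" "q + r \<ge> 1"
    and det: "det2 P = 1" "det2 U = 1"
    and fx: "flip2 (P * U) = P * U" "flip2 (P * flip2 U) = P * flip2 U"
  shows False
proof -
  define x y where "x = \<epsilon> * q" and "y = \<epsilon> * r"
  have P': "P = Mat2 p x y t" using P(1) by (simp add: x_def y_def)
  obtain \<kappa> where \<kappa>: "P * U = Mat2 \<kappa> 0 0 \<kappa>" "\<kappa> = 1 \<or> \<kappa> = - 1"
    using flip2_fixed_unimodular[OF fx(1)] det by (auto simp: det2_mult one_mat2_def)
  have "U = adj2 P * (P * U)"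
    using det adj2_mult_left[of P] by (metis mult.assoc mult_1)
  then have U: "U = Mat2 (\<kappa> * t) (- \<kappa> * x) (- \<kappa> * y) (\<kappa> * p)"
    using \<kappa>(1) P' by simp
  have Z2: "P * flip2 U = Mat2 (\<kappa> * (p * p - x * x)) (\<kappa> * (x * t - p * y)) (\<kappa> * (y * p - t * x)) (\<kappa> * (t * t - y * y))"
    unfolding U P' by (simp add: algebra_simps)
  have "det2 (flip2 U) = 1" using det(2) by (cases U) (simp add: algebra_simps)
  then have "P * flip2 U = 1 \<or> P * flip2 U = Mat2 (- 1) 0 0 (- 1)"
    using flip2_fixed_unimodular[OF fx(2)] det by (simp add: det2_mult)
  then have eq: "p * p - x * x = 1 \<or> p * p - x * x = - 1" "x * t = p * y"
    using \<kappa>(2) unfolding Z2 by (auto simp: one_mat2_def)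
  have xx: "x * x = q * q" "x * y = q * r"
  proof -
    have "x * x = (\<epsilon> * \<epsilon>) * (q * q)" "x * y = (\<epsilon> * \<epsilon>) * (q * r)"
      unfolding x_def y_def by (simp_all only: ac_simps)
    then show "x * x = q * q" "x * y = q * r" using P(2) by simp_all
  qed
  have d: "p * t - x * y = 1" using det(1) P' by simp
  \<comment> \<open>The relation \<open>x * t = p * y\<close> and the determinant combine to
    \<open>t * (p * p - x * x) = p\<close>. Since \<open>p\<close> and \<open>t\<close> are
    positive, the sign left open in \<open>eq\<close> is plus.\<close>
  have "t * (p * p - x * x) = p * (p * t) - x * (x * t)" by (simp add: algebra_simps)
  also have "\<dots> = p * (p * t - x * y)" using eq(2) by (simp add: algebra_simps)
  also have "\<dots> = p" using d by simp
  finally have "t * (p * p - x * x) = p" .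
  then have "p * p - x * x = 1" "t = p" using eq(1) P(3,4) by auto
  then have "(p - q) * (p + q) = 1" using xx by (simp add: algebra_simps)
  then have "p - q = 1 \<and> p + q = 1" using P(3,5) by (auto simp: zmult_eq_1_iff)
  then have "q = 0" "p = 1" by auto
  then have "x = 0" "y = 0" using eq(2) \<open>t = p\<close> by (auto simp: x_def)
  then have "r = 0" using P(2) unfolding y_def by auto
  then show False using \<open>q = 0\<close> P(7) by simp
qed

section \<open>Kempe switches along a closed trail\<close>

definition link :: "'e set \<Rightarrow> ('e \<Rightarrow> 'v) \<Rightarrow> ('e \<Rightarrow> 'v) \<Rightarrow> ('v \<times> 'v) set" where
  "link A src dst = {(a, b). \<exists>x \<in> A. (src x = a \<and> dst x = b) \<or> (src x = b \<and> dst x = a)}"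

text \<open>A label for components: vertices with the same reachable set receive the same choice.
  The label is itself a reachable vertex, which lets \<open>join_exists\<close> run paths to
  it.\<close>

definition component_rep :: "'e set \<Rightarrow> ('e \<Rightarrow> 'v) \<Rightarrow> ('e \<Rightarrow> 'v) \<Rightarrow> 'v \<Rightarrow> 'v" where
  "component_rep A src dst a = (SOME w. (a, w) \<in> (link A src dst)\<^sup>*)"

lemma component_rep_reachable: "(a, component_rep A src dst a) \<in> (link A src dst)\<^sup>*"
  unfolding component_rep_def by (rule someI) (rule rtrancl_refl)

lemma component_rep_ends_eq:
  assumes "x \<in> A"
  shows "component_rep A src dst (src x) = component_rep A src dst (dst x)"
proof -
  have "(src x, dst x) \<in> link A src dst" "(dst x, src x) \<in> link A src dst"
    using assms by (auto simp: link_def)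
  then have "(src x, w) \<in> (link A src dst)\<^sup>* \<longleftrightarrow> (dst x, w) \<in> (link A src dst)\<^sup>*" for w
    by (meson converse_rtrancl_into_rtrancl)
  then show ?thesis by (simp add: component_rep_def)
qed

section \<open>Flows relative to a closed trail and their switches\<close>

locale closed_trail =
  fixes E :: "'e set" and src dst :: "'e \<Rightarrow> 'v" and n :: nat
    and e :: "nat \<Rightarrow> 'e" and v :: "nat \<Rightarrow> 'v"
  assumes finite_E: "finite E"
    and inj: "inj_on e {..<n}"
    and trail_subset: "e ` {..<n} \<subseteq> E"
    and trail: "k < n \<Longrightarrow>
      (src (e k) = v k \<and> dst (e k) = v (Suc k)) \<or> (src (e k) = v (Suc k) \<and> dst (e k) = v k)"
    and closed: "v n = v 0"
begin

abbreviation outer :: "'e set" where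
  "outer \<equiv> E - e ` {..<n}"

definition circ :: "('e \<Rightarrow> bit) \<Rightarrow> ('v \<Rightarrow> bit) \<Rightarrow> bit" where
  "circ \<phi> \<rho> = (\<Sum>x \<in> E. \<phi> x * (\<rho> (src x) + \<rho> (dst x)))"

text \<open>A function on the edges is a \<open>\<int>\<^sub>2\<close>-flow iff it pairs to zero with every coboundary.\<close>

definition good :: "('e \<Rightarrow> bit \<times> bit) \<Rightarrow> bool" where
  "good g \<longleftrightarrow> (\<forall>\<rho>. circ (\<lambda>x. fst (g x)) \<rho> = 0) \<and> (\<forall>\<rho>. circ (\<lambda>x. snd (g x)) \<rho> = 0) \<and>
    (\<forall>x \<in> outer. g x \<noteq> 0)"

lemma circ_add: "circ (\<lambda>x. \<phi> x + \<psi> x) \<rho> = circ \<phi> \<rho> + circ \<psi> \<rho>"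
  by (simp add: circ_def algebra_simps sum.distrib)

lemma circ_split:
  "circ \<phi> \<rho> = pairing n v (\<phi> \<circ> e) \<rho> + (\<Sum>x \<in> outer. \<phi> x * (\<rho> (src x) + \<rho> (dst x)))"
proof -
  have "(\<Sum>x \<in> e ` {..<n}. \<phi> x * (\<rho> (src x) + \<rho> (dst x))) =
    (\<Sum>k<n. \<phi> (e k) * (\<rho> (src (e k)) + \<rho> (dst (e k))))"
    by (simp add: sum.reindex[OF inj])
  also have "\<dots> = pairing n v (\<phi> \<circ> e) \<rho>"
    unfolding pairing_def
  proof (rule sum.cong[OF refl])
    show "\<phi> (e k) * (\<rho> (src (e k)) + \<rho> (dst (e k))) = (\<phi> \<circ> e) k * (\<rho> (v k) + \<rho> (v (Suc k)))"
      if "k \<in> {..<n}" for k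
      using trail[of k] that by (auto simp: add.commute)
  qed
  finally show ?thesis
    unfolding circ_def using sum.subset_diff[OF trail_subset finite_E] by (metis add.commute)
qed

text \<open>\<open>\<psi>\<close> counts modulo 2 the edges of a walk in \<open>A\<close> from
  \<open>a\<close> to \<open>b\<close>; its boundary consists of the two ends.\<close>

lemma path_potential:
  assumes "(a, b) \<in> (link A src dst)\<^sup>*" "A \<subseteq> E"
  shows "\<exists>\<psi>. (\<forall>x. x \<notin> A \<longrightarrow> \<psi> x = 0) \<and> (\<forall>\<rho>. circ \<psi> \<rho> = \<rho> a + \<rho> b)"
  using assms(1)
proof (induction rule: rtrancl_induct)
  case base
  then show ?case by (intro exI[of _ "\<lambda>_. 0"]) (simp add: circ_def)
next
  case (step b c)
  then obtain \<psi> where \<psi>: "\<forall>x. x \<notin> A \<longrightarrow> \<psi> x = 0" "\<forall>\<rho>. circ \<psi> \<rho> = \<rho> a + \<rho> b" by auto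
  obtain x where x: "x \<in> A" "(src x = b \<and> dst x = c) \<or> (src x = c \<and> dst x = b)"
    using step.hyps(2) by (auto simp: link_def)
  have "circ (\<lambda>y. of_bool (y = x)) \<rho> = (\<Sum>y \<in> {x}. \<rho> (src y) + \<rho> (dst y))" for \<rho>
    unfolding circ_def using x(1) assms(2) finite_E
    by (intro sum.mono_neutral_cong_right) auto
  then have "circ (\<lambda>y. of_bool (y = x)) \<rho> = \<rho> b + \<rho> c" for \<rho>
    using x(2) by (auto simp: add.commute)
  then have "circ (\<lambda>y. \<psi> y + of_bool (y = x)) \<rho> = \<rho> a + \<rho> c" for \<rho>
    using \<psi>(2) by (simp add: circ_add add.assoc)
  then show ?case
    using \<psi>(1) x(1) by (intro exI[of _ "\<lambda>y. \<psi> y + of_bool (y = x)"]) auto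
qed

text \<open>A T-join inside \<open>A\<close>, where T is the set of odd vertices of
  \<open>j\<close>: it exists because each component meets T evenly. Paths run from the trail
  vertices to the representatives of their components, and admissibility cancels what arrives
  there.\<close>

lemma join_exists:
  assumes "A \<subseteq> E" "admissible n (component_rep A src dst \<circ> v) j"
  shows "\<exists>\<phi>. (\<forall>x. x \<notin> A \<longrightarrow> \<phi> x = 0) \<and> (\<forall>\<rho>. circ \<phi> \<rho> = pairing n v j \<rho>)"
proof -
  let ?r = "component_rep A src dst"
  have "\<forall>k. \<exists>\<psi>. (\<forall>x. x \<notin> A \<longrightarrow> \<psi> x = 0) \<and> (\<forall>\<rho>. circ \<psi> \<rho> = \<rho> (v k) + \<rho> (?r (v k)))"
    using path_potential[OF component_rep_reachable assms(1)] by blast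
  then obtain \<psi> where \<psi>: "\<And>k x. x \<notin> A \<Longrightarrow> \<psi> k x = 0"
    "\<And>k \<rho>. circ (\<psi> k) \<rho> = \<rho> (v k) + \<rho> (?r (v k))"
    by metis
  define \<phi> where "\<phi> x = (\<Sum>k<n. j k * (\<psi> k x + \<psi> (Suc k) x))" for x
  have "circ \<phi> \<rho> = pairing n v j \<rho>" for \<rho>
  proof -
    have "circ \<phi> \<rho> = (\<Sum>x \<in> E. \<Sum>k<n. j k * (\<psi> k x + \<psi> (Suc k) x) * (\<rho> (src x) + \<rho> (dst x)))"
      by (simp only: circ_def \<phi>_def sum_distrib_right)
    also have "\<dots> = (\<Sum>k<n. \<Sum>x \<in> E. j k * (\<psi> k x + \<psi> (Suc k) x) * (\<rho> (src x) + \<rho> (dst x)))"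
      by (rule sum.swap)
    also have "\<dots> = (\<Sum>k<n. j k * circ (\<lambda>x. \<psi> k x + \<psi> (Suc k) x) \<rho>)"
      by (simp only: circ_def sum_distrib_left mult.assoc)
    also have "\<dots> = (\<Sum>k<n. j k * (\<rho> (v k) + \<rho> (v (Suc k))) +
        j k * (\<rho> ((?r \<circ> v) k) + \<rho> ((?r \<circ> v) (Suc k))))"
      by (intro sum.cong) (simp_all add: circ_add \<psi>(2) algebra_simps)
    also have "\<dots> = pairing n v j \<rho> + pairing n (?r \<circ> v) j \<rho>"
      by (simp only: pairing_def sum.distrib)
    also have "pairing n (?r \<circ> v) j \<rho> = 0" using assms(2) by (simp only: admissible_def)
    finally show ?thesis by simp
  qed
  moreover have "\<phi> x = 0" if "x \<notin> A" for x
    using \<psi>(1)[OF that] by (simp add: \<phi>_def)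
  ultimately show ?thesis by blast
qed

abbreviation switch_class :: "('e \<Rightarrow> bit \<times> bit) \<Rightarrow> nat \<Rightarrow> 'v" where
  "switch_class g \<equiv> component_rep {x \<in> outer. snd (g x) = 1} src dst \<circ> v"

text \<open>The Kempe switch: \<open>j\<close> on the trail is completed by a join among the outer
  edges with second coordinate 1. Off the trail only those edges change, so no value there becomes
  0.\<close>

lemma switch_fst:
  assumes "good g" "admissible n (switch_class g) j"
  obtains g' where "good g'" "\<And>x. snd (g' x) = snd (g x)"
    "\<And>k. k < n \<Longrightarrow> fst (g' (e k)) = fst (g (e k)) + j k"
proof -
  let ?A = "{x \<in> outer. snd (g x) = 1}"
  obtain \<phi> where \<phi>: "\<And>x. x \<notin> ?A \<Longrightarrow> \<phi> x = 0" "\<And>\<rho>. circ \<phi> \<rho> = pairing n v j \<rho>"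
    using join_exists[OF _ assms(2)] by blast
  define \<gamma> where "\<gamma> x = (if x \<in> e ` {..<n} then j (the_inv_into {..<n} e x) else 0)" for x
  have \<gamma>: "\<gamma> (e k) = j k" if "k < n" for k
    using that the_inv_into_f_f[OF inj, of k] by (simp add: \<gamma>_def)
  have "pairing n v (\<gamma> \<circ> e) \<rho> = pairing n v j \<rho>" for \<rho>
    unfolding pairing_def by (intro sum.cong) (simp_all add: \<gamma>)
  then have circ_\<gamma>: "circ \<gamma> \<rho> = pairing n v j \<rho>" for \<rho>
    using circ_split[of \<gamma> \<rho>] by (simp add: \<gamma>_def)
  define g' where "g' x = (fst (g x) + (\<phi> x + \<gamma> x), snd (g x))" for x
  have "circ (\<lambda>x. fst (g' x)) \<rho> = 0" for \<rho>
    using assms(1) by (simp add: g'_def circ_add \<phi>(2) circ_\<gamma> good_def)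
  moreover have "g' x \<noteq> 0" if "x \<in> outer" for x
  proof (cases "snd (g x) = 1")
    case True
    then show ?thesis by (simp add: g'_def zero_prod_def)
  next
    case False
    then have "g' x = g x" using that \<phi>(1)[of x] by (simp add: g'_def \<gamma>_def prod_eq_iff)
    then show ?thesis using assms(1) that by (simp add: good_def)
  qed
  ultimately have "good g'" using assms(1) by (simp add: good_def g'_def)
  moreover have "fst (g' (e k)) = fst (g (e k)) + j k" if "k < n" for k
    using that \<phi>(1)[of "e k"] \<gamma>[OF that] by (simp add: g'_def)
  ultimately show thesis using that[of g'] by (simp add: g'_def)
qed

text \<open>Collapsing the components to points kills every outer edge: its second coordinate is 0
  or its ends share a label. What is left of the flow condition is admissibility on the
  trail.\<close>

lemma admissible_snd:
  assumes "good g"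
  shows "admissible n (switch_class g) (\<lambda>k. snd (g (e k)))"
  unfolding admissible_def
proof
  fix \<rho> :: "'v \<Rightarrow> bit"
  let ?A = "{x \<in> outer. snd (g x) = 1}"
  let ?\<rho> = "\<rho> \<circ> component_rep ?A src dst"
  have "snd (g x) * (?\<rho> (src x) + ?\<rho> (dst x)) = 0" if "x \<in> outer" for x
    using that component_rep_ends_eq[of x ?A src dst] by (cases "snd (g x)") simp_all
  then have "(\<Sum>x \<in> outer. snd (g x) * (?\<rho> (src x) + ?\<rho> (dst x))) = 0"
    by (rule sum.neutral[OF ballI])
  moreover have "circ (\<lambda>x. snd (g x)) ?\<rho> = 0" using assms by (simp only: good_def)
  ultimately have "pairing n v (\<lambda>k. snd (g (e k))) ?\<rho> = 0"
    using circ_split[of "\<lambda>x. snd (g x)" ?\<rho>] by (simp add: comp_def)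
  then show "pairing n (switch_class g) (\<lambda>k. snd (g (e k))) \<rho> = 0"
    by (simp add: pairing_def)
qed

lemma good_swap: "good g \<Longrightarrow> good (prod.swap \<circ> g)"
  by (auto simp: good_def zero_prod_def prod_eq_iff)

text \<open>A closed trail has even degrees, so its indicator can be added to either
  coordinate.\<close>

lemma good_shift:
  assumes "good g"
  shows "good (\<lambda>x. if x \<in> e ` {..<n} then g x + a else g x)"
proof -
  have circ_const: "circ (\<lambda>x. if x \<in> e ` {..<n} then b else 0) \<rho> = 0" for b \<rho>
  proof -
    have "pairing n v ((\<lambda>x. if x \<in> e ` {..<n} then b else 0) \<circ> e) \<rho> =
        b * pairing n v (interval_ind 0 n) \<rho>"
      unfolding pairing_def sum_distrib_left
      by (intro sum.cong) (auto simp: interval_ind_def)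
    then show ?thesis
      using circ_split[of "\<lambda>x. if x \<in> e ` {..<n} then b else 0" \<rho>] closed
      by (simp add: pairing_interval_ind)
  qed
  have "fst (if x \<in> e ` {..<n} then g x + a else g x) =
      fst (g x) + (if x \<in> e ` {..<n} then fst a else 0)"
    "snd (if x \<in> e ` {..<n} then g x + a else g x) =
      snd (g x) + (if x \<in> e ` {..<n} then snd a else 0)" for x
    by simp_all
  then show ?thesis
    using assms circ_const unfolding good_def by (simp add: circ_add)
qed

end

section \<open>Balanced flows\<close>

definition bit_sign :: "bit \<Rightarrow> int" where
  "bit_sign b = (if b = 0 then 1 else - 1)"

context closed_trail
begin

definition letter_weight :: "(nat \<Rightarrow> int) \<Rightarrow> ('e \<Rightarrow> bit \<times> bit) \<Rightarrow> bit \<times> bit \<Rightarrow> int" where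
  "letter_weight w g a = (\<Sum>k<n. of_bool (g (e k) = a) * w k)"

definition word_mat :: "(nat \<Rightarrow> int) \<Rightarrow> ('e \<Rightarrow> bit \<times> bit) \<Rightarrow> nat \<Rightarrow> nat \<Rightarrow> mat2" where
  "word_mat w g k l =
    prod_list (map (\<lambda>m. shear (fst (g (e m))) (bit_sign (snd (g (e m))) * w m)) [k..<l])"

lemma word_mat_concat: "k \<le> l \<Longrightarrow> l \<le> m \<Longrightarrow> word_mat w g k m = word_mat w g k l * word_mat w g l m"
  by (simp add: word_mat_def upt_split[of k l m])

lemma det2_word_mat: "det2 (word_mat w g k l) = 1"
  by (simp only: word_mat_def det2_prod_shear)

lemma word_mat_same:
  assumes "\<And>m. k \<le> m \<Longrightarrow> m < l \<Longrightarrow> g' (e m) = g (e m)"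
  shows "word_mat w g' k l = word_mat w g k l"
  unfolding word_mat_def using assms by (intro arg_cong[where f = prod_list] map_cong) auto

lemma word_mat_flipped:
  assumes "\<And>m. k \<le> m \<Longrightarrow> m < l \<Longrightarrow> fst (g' (e m)) = fst (g (e m)) + 1"
    and "\<And>x. snd (g' x) = snd (g x)"
  shows "word_mat w g' k l = flip2 (word_mat w g k l)"
  unfolding word_mat_def flip2_prod_shear
  using assms by (intro arg_cong[where f = prod_list] map_cong) auto

end

text \<open>The situation of a counterexample: every good function takes the value 0 on at least a
  quarter of the weight. \<open>no_good\<close> then excludes good functions altogether.\<close>

locale balanced_trail = closed_trail +
  fixes w :: "nat \<Rightarrow> int"
  assumes weight_pos: "k < n \<Longrightarrow> w k > 0"
    and n_pos: "n > 0"
    and not_small: "good g \<Longrightarrow> (\<Sum>k<n. w k) \<le> 4 * letter_weight w g 0"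
begin

lemma letters_equidistributed:
  assumes "good g"
  shows "4 * letter_weight w g a = (\<Sum>k<n. w k)"
proof -
  have ge: "(\<Sum>k<n. w k) \<le> 4 * letter_weight w g b" for b
  proof -
    \<comment> \<open>Each element is its own inverse, so shifting by \<open>b\<close> moves exactly
      the letter \<open>b\<close> to 0.\<close>
    let ?g = "\<lambda>x. if x \<in> e ` {..<n} then g x + b else g x"
    have "x + b = 0 \<longleftrightarrow> x = b" for x :: "bit \<times> bit"
      by (simp add: prod_eq_iff bit_add_eq_0_iff)
    then have "letter_weight w ?g 0 = letter_weight w g b"
      unfolding letter_weight_def by (intro sum.cong) auto
    then show ?thesis using not_small[OF good_shift[OF assms, of b]] by simp
  qed
  have one: "of_bool (x = (0, 0)) * z + of_bool (x = (0, 1)) * z + of_bool (x = (1, 0)) * z +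
      of_bool (x = (1, 1)) * z = z" for x :: "bit \<times> bit" and z :: int
    by (cases x; cases "fst x"; cases "snd x") simp_all
  have "letter_weight w g (0, 0) + letter_weight w g (0, 1) + letter_weight w g (1, 0) +
      letter_weight w g (1, 1) = (\<Sum>k<n. w k)"
    unfolding letter_weight_def sum.distrib[symmetric] one ..
  moreover have "a = (0, 0) \<or> a = (0, 1) \<or> a = (1, 0) \<or> a = (1, 1)"
    by (cases a; cases "fst a"; cases "snd a") simp_all
  ultimately show ?thesis using ge[of "(0, 0)"] ge[of "(0, 1)"] ge[of "(1, 0)"] ge[of "(1, 1)"]
    by auto
qed

lemma signed_weight_zero:
  assumes "good g"
  shows "(\<Sum>k<n. of_bool (fst (g (e k)) = b) * (bit_sign (snd (g (e k))) * w k)) = 0"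
proof -
  have eq: "of_bool (fst x = b) * (bit_sign (snd x) * z) = of_bool (x = (b, 0)) * z - of_bool (x = (b, 1)) * z"
    for x :: "bit \<times> bit" and z
    by (cases x; cases "snd x") (auto simp: bit_sign_def)
  have "(\<Sum>k<n. of_bool (fst (g (e k)) = b) * (bit_sign (snd (g (e k))) * w k)) =
      letter_weight w g (b, 0) - letter_weight w g (b, 1)"
    unfolding eq letter_weight_def sum_subtractf ..
  then show ?thesis
    using letters_equidistributed[OF assms, of "(b, 0)"] letters_equidistributed[OF assms, of "(b, 1)"]
    by simp
qed

text \<open>After swapping coordinates, \<open>switch_fst\<close> acts on the signs. A switch along
  \<open>j\<close> negates exactly the letters in \<open>j\<close>, so twice the weight of
  \<open>j\<close> is a difference of two signed weights that are both 0.\<close>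

lemma word_mat_trivial:
  assumes "good g"
  shows "word_mat w g 0 n = 1"
proof -
  let ?g = "prod.swap \<circ> g"
  have swap: "good ?g" using assms by (rule good_swap)
  let ?t = "\<lambda>k. fst (g (e k))" and ?s = "\<lambda>k. bit_sign (snd (g (e k))) * w k"
  have "prod_list (map (\<lambda>k. shear (?t k) (?s k)) [0..<n]) = 1"
  proof (rule closed_walk_product_trivial[OF shear_0 shear_add])
    show "switch_class ?g n = switch_class ?g 0" using closed by simp
    show "admissible n (switch_class ?g) ?t"
      using admissible_snd[OF swap] by simp
    show "wsum n ?t ?s b j = 0" if adm: "admissible n (switch_class ?g) j" for j b
    proof -
      obtain g' where g': "good g'" "\<And>x. snd (g' x) = snd (?g x)"
        "\<And>k. k < n \<Longrightarrow> fst (g' (e k)) = fst (?g (e k)) + j k"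
        by (rule switch_fst[OF swap adm]) blast
      let ?g' = "prod.swap \<circ> g'"
      have "2 * wsum n ?t ?s b j =
        (\<Sum>k<n. of_bool (?t k = b) * ?s k - of_bool (fst (?g' (e k)) = b) * (bit_sign (snd (?g' (e k))) * w k))"
        unfolding wsum_def sum_distrib_left
      proof (rule sum.cong[OF refl])
        show "2 * (of_bool (j k = 1 \<and> ?t k = b) * ?s k) =
          of_bool (?t k = b) * ?s k - of_bool (fst (?g' (e k)) = b) * (bit_sign (snd (?g' (e k))) * w k)"
          if "k \<in> {..<n}" for k
          using that g'(2)[of "e k"] g'(3)[of k]
          by (cases "j k"; cases "snd (g (e k))") (auto simp: bit_sign_def)
      qed
      also have "\<dots> = 0"
        using signed_weight_zero[OF assms, of b] signed_weight_zero[OF good_swap[OF g'(1)], of b]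
        by (simp add: sum_subtractf)
      finally show ?thesis by simp
    qed
  qed
  then show ?thesis by (simp add: word_mat_def)
qed

text \<open>A switch on the arc flips the middle word and leaves the words before and after it. Both
  total products are 1, so the middle factors agree.\<close>

lemma word_mat_flip2_fixed:
  assumes "good g" "k \<le> l" "l < n" "switch_class g k = switch_class g l"
  shows "flip2 (word_mat w g k l) = word_mat w g k l"
proof -
  have "admissible n (switch_class g) (interval_ind k l)"
    using assms by (intro admissible_interval_ind) auto
  from switch_fst[OF assms(1) this] obtain g' where g': "good g'" "\<And>x. snd (g' x) = snd (g x)"
      "\<And>m. m < n \<Longrightarrow> fst (g' (e m)) = fst (g (e m)) + interval_ind k l m"
    by blast
  have "word_mat w g' 0 k = word_mat w g 0 k" "word_mat w g' l n = word_mat w g l n"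
    using g' assms by (auto intro!: word_mat_same simp: prod_eq_iff interval_ind_def)
  moreover have "word_mat w g' k l = flip2 (word_mat w g k l)"
    using g' assms by (intro word_mat_flipped) (auto simp: interval_ind_def)
  moreover have "word_mat w h 0 k * word_mat w h k l * word_mat w h l n = 1" if "good h" for h
    using word_mat_trivial[OF that] word_mat_concat[of 0 k n w h] word_mat_concat[of k l n w h] assms
    by (simp add: mult.assoc)
  ultimately show ?thesis
    using mult_cancel_middle[OF _ _ det2_word_mat det2_word_mat] assms(1) g'(1) by metis
qed

lemma no_good: "\<not> good g"
proof
  assume g: "good g"
  let ?t = "\<lambda>k. snd (g (e k))" and ?c = "switch_class g"
  \<comment> \<open>With a constant second coordinate the letter \<open>(0, ?t 0 + 1)\<close> would
    have no weight, against equidistribution.\<close>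
  have "changes n ?t \<noteq> {}"
  proof
    assume "changes n ?t = {}"
    then have const: "?t k = ?t 0" if "k < n" for k
      using constant_between_changes[of n n 0 ?t k] that by simp
    have "letter_weight w g (0, ?t 0 + 1) = 0"
      unfolding letter_weight_def
    proof (rule sum.neutral[OF ballI])
      show "of_bool (g (e k) = (0, ?t 0 + 1)) * w k = 0" if "k \<in> {..<n}" for k
        using const[of k] that by (cases "?t 0") auto
    qed
    moreover have "(\<Sum>k<n. w k) > 0"
      using weight_pos n_pos by (intro sum_pos) auto
    ultimately show False
      using letters_equidistributed[OF g, of "(0, ?t 0 + 1)"] by simp
  qed
  moreover have "?c n = ?c 0" using closed by simp
  ultimately obtain k q l where K: "k < q" "q \<le> l" "l < n" "?c k = ?c l"
    and const: "\<And>m. k \<le> m \<Longrightarrow> m < q \<Longrightarrow> ?t m = ?t k"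
    and r: "q = l \<or> (\<exists>r<n. ?c r = ?c q \<and> (r < k \<or> l < r))"
    using changes_closest_pair[OF admissible_snd[OF g], of thesis for thesis] by blast
  let ?P = "word_mat w g k q" and ?U = "word_mat w g q l"
  have concat: "word_mat w h k l = word_mat w h k q * word_mat w h q l" for h
    using K by (intro word_mat_concat) auto
  have fixed: "flip2 (?P * ?U) = ?P * ?U"
    using word_mat_flip2_fixed[OF g _ K(3,4)] K concat by simp
  \<comment> \<open>A second switch, along the arc between \<open>q\<close> and its partner
    \<open>r\<close>, flips exactly one of \<open>?P\<close> and \<open>?U\<close>.\<close>
  have fixed': "flip2 (?P * flip2 ?U) = ?P * flip2 ?U"
  proof (cases "q = l")
    case True
    then have "?U = 1" by (simp add: word_mat_def)
    then show ?thesis using fixed by simp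
  next
    case False
    then obtain r where r: "r < n" "?c r = ?c q" "r < k \<or> l < r" using r by blast
    define a b where "a = min r q" and "b = max r q"
    have "admissible n ?c (interval_ind a b)"
      using r K by (intro admissible_interval_ind) (auto simp: a_def b_def min_def max_def)
    from switch_fst[OF g this] obtain g' where g': "good g'" "\<And>x. snd (g' x) = snd (g x)"
        "\<And>m. m < n \<Longrightarrow> fst (g' (e m)) = fst (g (e m)) + interval_ind a b m"
      by blast
    \<comment> \<open>Second coordinates, and with them the components, are unchanged, so the switch
      from \<open>k\<close> to \<open>l\<close> remains available for \<open>g'\<close>.\<close>
    have "switch_class g' = ?c" using g'(2) by simp
    then have "switch_class g' k = switch_class g' l" using K(4) by simp
    with K have "flip2 (word_mat w g' k l) = word_mat w g' k l"
      by (intro word_mat_flip2_fixed[OF g'(1)]) simp_all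
    then have *: "flip2 (word_mat w g' k q * word_mat w g' q l) = word_mat w g' k q * word_mat w g' q l"
      by (simp only: concat)
    show ?thesis
    proof (cases "r < k")
      case True
      then have "a = r" "b = q" using K by (auto simp: a_def b_def)
      then have "word_mat w g' k q = flip2 ?P" "word_mat w g' q l = ?U"
        using g' K True
        by (auto intro!: word_mat_same word_mat_flipped simp: prod_eq_iff interval_ind_def)
      \<comment> \<open>Here \<open>flip2 ?P * ?U\<close> is fixed; applying \<open>flip2\<close>
        moves the flip from \<open>?P\<close> to \<open>?U\<close>.\<close>
      then show ?thesis using * by (simp add: flip2_mult)
    next
      case False
      then have "a = q" "b = r" "l < r" using r K by (auto simp: a_def b_def)
      then have "word_mat w g' k q = ?P" "word_mat w g' q l = flip2 ?U"
        using g' K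
        by (auto intro!: word_mat_same word_mat_flipped simp: prod_eq_iff interval_ind_def)
      then show ?thesis using * by simp
    qed
  qed
  have P: "?P = prod_list (map (\<lambda>m. shear (fst (g (e m))) (bit_sign (?t k) * w m)) [k..<q])"
    unfolding word_mat_def
  proof (intro arg_cong[where f = prod_list] map_cong refl)
    show "shear (fst (g (e m))) (bit_sign (?t m) * w m) = shear (fst (g (e m))) (bit_sign (?t k) * w m)"
      if "m \<in> set [k..<q]" for m
      using const[of m] that by simp
  qed
  have sq: "bit_sign (?t k) * bit_sign (?t k) = 1" by (simp add: bit_sign_def)
  have pos: "w m > 0" if "m \<in> set [k..<q]" for m using that K weight_pos by auto
  have "[k..<q] \<noteq> []" using K(1) by simp
  then obtain p x y z where
    P': "?P = Mat2 p (bit_sign (?t k) * x) (bit_sign (?t k) * y) z"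
      "p \<ge> 1" "z \<ge> 1" "x \<ge> 0" "y \<ge> 0" "x + y \<ge> 1"
    using prod_shear_same_sign[where xs = "[k..<q]" and w = w and b = "\<lambda>m. fst (g (e m))", OF sq pos] unfolding P by blast
  show False
    by (rule same_sign_not_flip2_fixed[OF P'(1) sq P'(2-6) det2_word_mat det2_word_mat fixed fixed'])
qed

end

section \<open>Circuits and flows of multigraphs\<close>

definition is_trail ::
  "'e set \<Rightarrow> ('e \<Rightarrow> 'v) \<Rightarrow> ('e \<Rightarrow> 'v) \<Rightarrow> nat \<Rightarrow> (nat \<Rightarrow> 'e) \<Rightarrow> (nat \<Rightarrow> 'v) \<Rightarrow> bool" where
  "is_trail E src dst n e v \<longleftrightarrow> inj_on e {..<n} \<and> e ` {..<n} \<subseteq> E \<and>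
    (\<forall>k<n. (src (e k) = v k \<and> dst (e k) = v (Suc k)) \<or> (src (e k) = v (Suc k) \<and> dst (e k) = v k))"

definition inc :: "('e \<Rightarrow> 'v) \<Rightarrow> ('e \<Rightarrow> 'v) \<Rightarrow> 'v \<Rightarrow> 'e \<Rightarrow> nat" where
  "inc src dst u x = of_bool (src x = u) + of_bool (dst x = u)"

lemma degree_eq_sum_inc:
  assumes "finite (edges H)" "\<And>x. x \<in> edges H \<Longrightarrow> ends H x = Upair (src x) (dst x)"
  shows "degree H u = (\<Sum>x \<in> edges H. inc src dst u x)"
proof -
  have "{x \<in> edges H. u \<in> set_uprod (ends H x)} = {x \<in> edges H. src x = u \<or> dst x = u}"
    "{x \<in> edges H. ends H x = Upair u u} = {x \<in> edges H. src x = u \<and> dst x = u}"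
    using assms(2) by auto
  moreover have "card {x \<in> edges H. Q x} = (\<Sum>x \<in> edges H. of_bool (Q x))" for Q
    using assms(1) by (simp add: sum_of_bool_eq Int_def)
  ultimately have "degree H u = (\<Sum>x \<in> edges H. of_bool (src x = u \<or> dst x = u)) +
      (\<Sum>x \<in> edges H. of_bool (src x = u \<and> dst x = u))"
    by (simp only: degree_def)
  also have "\<dots> = (\<Sum>x \<in> edges H. inc src dst u x)"
    unfolding sum.distrib[symmetric] by (intro sum.cong) (auto simp: inc_def)
  finally show ?thesis .
qed

text \<open>Each visit uses one end on arrival and one on departure, except at the start and the
  finish. The correction for \<open>v 0\<close> stands on the left to avoid subtraction of
  naturals.\<close>

lemma sum_inc_trail:
  assumes "is_trail E src dst n e v"
  shows "(\<Sum>x \<in> e ` {..<n}. inc src dst u x) + of_bool (v 0 = u) =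
    2 * (\<Sum>k<n. of_bool (v k = u)) + of_bool (v n = u)"
proof -
  have "(\<Sum>x \<in> e ` {..<n}. inc src dst u x) = (\<Sum>k<n. inc src dst u (e k))"
    using assms by (simp add: is_trail_def sum.reindex)
  also have "\<dots> = (\<Sum>k<n. of_bool (v k = u) + of_bool (v (Suc k) = u))"
  proof (rule sum.cong[OF refl])
    show "inc src dst u (e k) = of_bool (v k = u) + of_bool (v (Suc k) = u)" if "k \<in> {..<n}" for k
    proof -
      have "(src (e k) = v k \<and> dst (e k) = v (Suc k)) \<or> (src (e k) = v (Suc k) \<and> dst (e k) = v k)"
        using assms that by (simp add: is_trail_def)
      then show ?thesis by (elim disjE conjE) (simp_all add: inc_def)
    qed
  qed
  finally have "(\<Sum>x \<in> e ` {..<n}. inc src dst u x) =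
      (\<Sum>k<n. of_bool (v k = u)) + (\<Sum>k<n. of_bool (v (Suc k) = u))"
    by (simp only: sum.distrib)
  moreover have "(\<Sum>k<n. of_bool (v (Suc k) = u)) + of_bool (v 0 = u) =
      (\<Sum>k<n. of_bool (v k = u)) + (of_bool (v n = u) :: nat)"
    using sum.lessThan_Suc_shift[of "\<lambda>k. of_bool (v k = u) :: nat" n]
      sum.lessThan_Suc[of "\<lambda>k. of_bool (v k = u) :: nat" n] by linarith
  ultimately show ?thesis by linarith
qed

lemma is_trail_extend:
  assumes "is_trail E src dst n e v" "x \<in> E" "x \<notin> e ` {..<n}" "inc src dst (v n) x > 0"
  shows "\<exists>e' v'. is_trail E src dst (Suc n) e' v' \<and> v' 0 = v 0"
proof -
  define y where "y = (if src x = v n then dst x else src x)"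
  have x: "(src x = v n \<and> dst x = y) \<or> (src x = y \<and> dst x = v n)"
    using assms(4) by (auto simp: inc_def y_def split: if_splits)
  let ?e = "e(n := x)" and ?v = "v(Suc n := y)"
  have "?e ` {..<Suc n} = insert x (e ` {..<n})" by (auto simp: lessThan_Suc)
  moreover have "inj_on ?e {..<Suc n}"
    using assms(1,3) by (auto simp: is_trail_def inj_on_def less_Suc_eq)
  ultimately have "is_trail E src dst (Suc n) ?e ?v"
    using assms(1,2) x by (auto simp: is_trail_def less_Suc_eq)
  then show ?thesis by (intro exI[of _ ?e] exI[of _ ?v]) simp
qed

text \<open>A longest trail cannot be extended, so parity at its last vertex closes it. It then
  exhausts the degree of each visited vertex, and connectedness carries this to all of
  \<open>C\<close>.\<close>

lemma circuit_closed_trail: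
  assumes "circuit C" and or: "\<And>x. x \<in> edges C \<Longrightarrow> ends C x = Upair (src x) (dst x)"
  obtains n e v where "n > 0" "is_trail (edges C) src dst n e v" "e ` {..<n} = edges C" "v n = v 0"
proof -
  have fin: "finite (edges C)" and conn: "connected_graph C" and mg: "multigraph C"
    using assms(1) by (simp_all add: circuit_def finite_multigraph_def finite_multigraph_axioms_def)
  have deg: "degree C u = 2" if "u \<in> vertices C" for u
    using assms(1) that by (simp add: circuit_def regular_def)
  have "vertices C \<noteq> {}" using assms(1) by (simp add: circuit_def connected_graph_def)
  then obtain u0 where u0: "u0 \<in> vertices C" by blast
  have ends_V: "src x \<in> vertices C" "dst x \<in> vertices C" if "x \<in> edges C" for x
    using multigraph.ends_in_vertices[OF mg that] or[OF that] by auto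
  have deg2: "(\<Sum>x \<in> edges C. inc src dst u x) = 2" if "u \<in> vertices C" for u
    using deg[OF that] degree_eq_sum_inc[OF fin or] by simp
  \<comment> \<open>The condition on \<open>v 0\<close> anchors even the empty trail in
    \<open>C\<close>.\<close>
  define T where "T n \<longleftrightarrow> (\<exists>e v. is_trail (edges C) src dst n e v \<and> v 0 \<in> vertices C)" for n
  have T0: "T 0" unfolding T_def is_trail_def using u0
    by (intro exI[of _ undefined] exI[of _ "\<lambda>_. u0"]) simp
  have bound: "n \<le> card (edges C)" if Tn: "T n" for n
  proof -
    obtain e v where "is_trail (edges C) src dst n e v" using Tn unfolding T_def by auto
    then have "card (e ` {..<n}) = n" "e ` {..<n} \<subseteq> edges C"
      by (auto simp: is_trail_def card_image)
    then show ?thesis using card_mono[OF fin] by metis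
  qed
  define n where "n = (GREATEST n. T n)"
  have "T n" unfolding n_def using T0 by (rule GreatestI_nat) (rule bound)
  have max: "\<not> T (Suc n)"
  proof
    assume "T (Suc n)"
    then have "Suc n \<le> n" unfolding n_def by (rule Greatest_le_nat) (rule bound)
    then show False by simp
  qed
  obtain e v where tr: "is_trail (edges C) src dst n e v" and v0: "v 0 \<in> vertices C"
    using \<open>T n\<close> unfolding T_def by auto
  have sub: "e ` {..<n} \<subseteq> edges C" using tr by (simp add: is_trail_def)
  have v_in: "v k \<in> vertices C" if "k \<le> n" for k
  proof (cases k)
    case (Suc i)
    then have "i < n" using that by simp
    then have "e i \<in> edges C" "v k = src (e i) \<or> v k = dst (e i)"
      using tr Suc unfolding is_trail_def by (blast, metis)
    then show ?thesis using ends_V by auto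
  qed (use v0 in simp)
  have split: "(\<Sum>x \<in> edges C - e ` {..<n}. inc src dst u x) + (\<Sum>x \<in> e ` {..<n}. inc src dst u x) = 2"
    if "u \<in> vertices C" for u
    using deg2[OF that] sum.subset_diff[OF sub fin, of "inc src dst u"] by simp
  have "(\<Sum>x \<in> edges C - e ` {..<n}. inc src dst (v n) x) = 0"
  proof (rule ccontr)
    assume "\<not> ?thesis"
    then obtain x where "x \<in> edges C - e ` {..<n}" "inc src dst (v n) x > 0"
      by (metis (no_types, lifting) neq0_conv sum.neutral)
    then have "T (Suc n)"
      using is_trail_extend[OF tr] v0 unfolding T_def by (metis DiffD1 DiffD2)
    then show False using max by simp
  qed
  \<comment> \<open>If \<open>v n\<close> differed from \<open>v 0\<close>, this would equate 2 with
    an odd number; for \<open>n = 0\<close> it would read 3 = 1.\<close>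
  then have count: "2 + of_bool (v 0 = v n) = 2 * (\<Sum>k<n. of_bool (v k = v n)) + (1::nat)"
    using split[OF v_in[OF order_refl]] sum_inc_trail[OF tr, of "v n"] by simp
  have closed: "v n = v 0"
  proof (rule ccontr)
    assume "v n \<noteq> v 0"
    then have "2 = 2 * (\<Sum>k<n. of_bool (v k = v n)) + (1::nat)" using count by simp
    then show False by presburger
  qed
  have n: "n > 0"
  proof (rule ccontr)
    assume "\<not> n > 0"
    then show False using count by simp
  qed
  \<comment> \<open>The closed trail uses at least two ends at each of its vertices, which leaves
    none for another edge.\<close>
  have used: "x \<in> e ` {..<n}" if "k < n" "x \<in> edges C" "inc src dst (v k) x > 0" for k x
  proof (rule ccontr)
    assume "x \<notin> e ` {..<n}"
    then have "(\<Sum>x \<in> edges C - e ` {..<n}. inc src dst (v k) x) > 0"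
      using that fin by (intro sum_pos2[of _ x]) auto
    moreover have "(\<Sum>i<n. of_bool (v i = v k)) > (0::nat)"
      using that(1) by (intro sum_pos2[of _ k]) auto
    ultimately show False
      using split[OF v_in[of k]] sum_inc_trail[OF tr, of "v k"] closed that(1) by simp
  qed
  have visited: "u \<in> v ` {..<n}" if "(v 0, u) \<in> (adjacency C)\<^sup>*" for u
    using that
  proof (induction rule: rtrancl_induct)
    case base
    then show ?case using n by blast
  next
    case (step a b)
    then obtain k where k: "k < n" "a = v k" by auto
    obtain x where x: "x \<in> edges C" "ends C x = Upair a b"
      using step.hyps(2) by (auto simp: adjacency_def)
    then have ab: "(src x = a \<and> dst x = b) \<or> (src x = b \<and> dst x = a)"
      using or[OF x(1)] by auto
    then have "x \<in> e ` {..<n}" using used[OF k(1) x(1)] k by (auto simp: inc_def)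
    then obtain i where i: "i < n" "x = e i" by auto
    then have "b = v i \<or> b = v (Suc i)" using tr ab by (auto simp: is_trail_def)
    moreover have "v (Suc i) \<in> v ` {..<n}"
      using i(1) closed n by (cases "Suc i = n") auto
    ultimately show ?case using i(1) by auto
  qed
  have "edges C \<subseteq> e ` {..<n}"
  proof
    fix x assume x: "x \<in> edges C"
    then have "(v 0, src x) \<in> (adjacency C)\<^sup>*"
      using conn v0 ends_V by (simp add: connected_graph_def)
    then obtain k where "k < n" "src x = v k" using visited by blast
    then show "x \<in> e ` {..<n}" using used[of k x] x by (simp add: inc_def)
  qed
  then show thesis using that[OF n tr _ closed] sub by blast
qed

text \<open>Modulo 2 the condition at a vertex says that the sum over all edge ends there is 0.
  Grouping edges by their ends turns the pairing into a sum over vertices, and vertex indicators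
  recover the separate conditions.\<close>

lemma flow_iff_coboundary:
  fixes \<phi> :: "'e \<Rightarrow> bit"
  assumes "finite_multigraph G" "orientation G D"
  shows "(\<forall>u \<in> vertices G. (\<Sum>x \<in> out_arcs D u. \<phi> x) = (\<Sum>x \<in> in_arcs D u. \<phi> x)) \<longleftrightarrow>
    (\<forall>\<rho>. (\<Sum>x \<in> edges G. \<phi> x * (\<rho> (tail D x) + \<rho> (head D x))) = 0)"
proof -
  have fin: "finite (vertices G)" "finite (edges G)"
    using assms(1) by (auto simp: finite_multigraph_def finite_multigraph_axioms_def)
  have arcs: "arcs D = edges G" using assms(2) by (simp add: orientation_def)
  have mem: "tail D x \<in> vertices G" "head D x \<in> vertices G" if "x \<in> edges G" for x
  proof -
    have "multigraph G" using assms(1) by (simp add: finite_multigraph_def)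
    then have "set_uprod (Upair (tail D x) (head D x)) \<subseteq> vertices G"
      using multigraph.ends_in_vertices[of G x] assms(2) that by (simp add: orientation_def)
    then show "tail D x \<in> vertices G" "head D x \<in> vertices G" by auto
  qed
  have group: "(\<Sum>x \<in> edges G. \<phi> x * \<rho> (h x)) = (\<Sum>u \<in> vertices G. \<rho> u * (\<Sum>x \<in> {x \<in> edges G. h x = u}. \<phi> x))"
    if "h ` edges G \<subseteq> vertices G" for h \<rho>
    unfolding sum.group[OF fin(2,1) that, symmetric] sum_distrib_left
    by (intro sum.cong) (auto simp: mult.commute)
  have key: "(\<Sum>x \<in> edges G. \<phi> x * (\<rho> (tail D x) + \<rho> (head D x))) =
      (\<Sum>u \<in> vertices G. \<rho> u * ((\<Sum>x \<in> out_arcs D u. \<phi> x) + (\<Sum>x \<in> in_arcs D u. \<phi> x)))" for \<rho>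
    using group[of "tail D" \<rho>] group[of "head D" \<rho>] mem
    by (simp add: distrib_left sum.distrib out_arcs_def in_arcs_def arcs image_subset_iff)
  show ?thesis
  proof
    assume *: "\<forall>\<rho>. (\<Sum>x \<in> edges G. \<phi> x * (\<rho> (tail D x) + \<rho> (head D x))) = 0"
    have zero: "(\<Sum>u \<in> vertices G. of_bool (u = a) * ((\<Sum>x \<in> out_arcs D u. \<phi> x) + (\<Sum>x \<in> in_arcs D u. \<phi> x))) = 0"
      for a by (rule trans[OF key[of "\<lambda>u. of_bool (u = a)", symmetric] spec[OF *]])
    show "\<forall>u \<in> vertices G. (\<Sum>x \<in> out_arcs D u. \<phi> x) = (\<Sum>x \<in> in_arcs D u. \<phi> x)"
    proof
      fix a assume "a \<in> vertices G"
      then have "(\<Sum>u \<in> vertices G. of_bool (u = a) * ((\<Sum>x \<in> out_arcs D u. \<phi> x) + (\<Sum>x \<in> in_arcs D u. \<phi> x))) =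
          (\<Sum>u \<in> {a}. (\<Sum>x \<in> out_arcs D u. \<phi> x) + (\<Sum>x \<in> in_arcs D u. \<phi> x))"
        using fin(1) by (intro sum.mono_neutral_cong_right) auto
      then show "(\<Sum>x \<in> out_arcs D a. \<phi> x) = (\<Sum>x \<in> in_arcs D a. \<phi> x)"
        using zero[of a] by (simp only: bit_add_eq_0_iff) (simp add: bit_add_eq_0_iff)
    qed
  next
    assume *: "\<forall>u \<in> vertices G. (\<Sum>x \<in> out_arcs D u. \<phi> x) = (\<Sum>x \<in> in_arcs D u. \<phi> x)"
    have "(\<Sum>u \<in> vertices G. \<rho> u * ((\<Sum>x \<in> out_arcs D u. \<phi> x) + (\<Sum>x \<in> in_arcs D u. \<phi> x))) = 0" for \<rho>
    proof (rule sum.neutral[OF ballI])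
      show "\<rho> u * ((\<Sum>x \<in> out_arcs D u. \<phi> x) + (\<Sum>x \<in> in_arcs D u. \<phi> x)) = 0" if "u \<in> vertices G" for u
        using *[rule_format, OF that] by (simp only: bit_add_self mult_zero_right)
    qed
    then show "\<forall>\<rho>. (\<Sum>x \<in> edges G. \<phi> x * (\<rho> (tail D x) + \<rho> (head D x))) = 0"
      unfolding key by blast
  qed
qed

theorem theorem1p3:
  fixes G C :: "('v, 'e) multigraph" and \<omega> :: "'e \<Rightarrow> nat" and f :: "'e \<Rightarrow> bit \<times> bit"
  assumes "finite_multigraph G"
    and "circuit_of C G"
    and "\<And>e. e \<in> edges G \<Longrightarrow> \<omega> e > 0"
    and "(\<Sum>e \<in> edges C. \<omega> e) \<le> 35"
    and "Z2Z2_flow G f"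
    and "edges G - edges C \<subseteq> supp G f"
  shows "\<exists>g. Z2Z2_flow G g \<and> edges G - edges C \<subseteq> supp G g \<and>
    real (\<Sum>e \<in> {e \<in> edges C. g e = (0, 0)}. \<omega> e) < 1 / 4 * real (\<Sum>e \<in> edges C. \<omega> e)"
proof (rule ccontr)
  assume contra: "\<not> ?thesis"
  \<comment> \<open>One orientation, taken from \<open>f\<close>, serves for all flows considered
    below.\<close>
  obtain D where D: "is_flow G D f" using assms(5) by (auto simp: Z2Z2_flow_def)
  then have orient: "orientation G D" by (simp add: is_flow_def)
  have circuit: "circuit C" and sub: "edges C \<subseteq> edges G"
    using assms(2) by (simp_all add: circuit_of_def subgraph_of_def)
  have "ends C x = Upair (tail D x) (head D x)" if "x \<in> edges C" for x
    using assms(2) orient that sub by (auto simp: circuit_of_def subgraph_of_def orientation_def)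
  then obtain n e v where n: "n > 0" and tr: "is_trail (edges C) (tail D) (head D) n e v"
    and EC: "e ` {..<n} = edges C" and closed: "v n = v 0"
    by (rule circuit_closed_trail[OF circuit])
  have inj: "inj_on e {..<n}" using tr by (simp add: is_trail_def)
  interpret closed_trail "edges G" "tail D" "head D" n e v
  proof
    show "finite (edges G)" using assms(1) by (rule finite_multigraph.finite_edges)
  qed (use tr sub closed in \<open>auto simp: is_trail_def\<close>)
  have flow: "is_flow G D g \<longleftrightarrow>
      (\<forall>\<rho>. circ (\<lambda>x. fst (g x)) \<rho> = 0) \<and> (\<forall>\<rho>. circ (\<lambda>x. snd (g x)) \<rho> = 0)"
    for g :: "'e \<Rightarrow> bit \<times> bit"
    unfolding circ_def flow_iff_coboundary[OF assms(1) orient, symmetric] is_flow_def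
    using orient by (auto simp: prod_eq_iff fst_sum snd_sum)
  have good_iff: "good g \<longleftrightarrow> is_flow G D g \<and> edges G - edges C \<subseteq> supp G g" for g
    unfolding good_def flow EC by (auto simp: supp_def)
  have sum_C: "(\<Sum>k<n. h (e k)) = (\<Sum>x \<in> edges C. h x)" for h :: "'e \<Rightarrow> int"
    using sum.reindex[OF inj, of h] by (simp add: EC)
  \<comment> \<open>The negated claim supplies \<open>not_small\<close>: a good function with less
    than a quarter of the weight at 0 would be a \<open>g\<close> as required.\<close>
  interpret balanced_trail "edges G" "tail D" "head D" n e v "\<lambda>k. int (\<omega> (e k))"
  proof
    show "int (\<omega> (e k)) > 0" if "k < n" for k
      using assms(3)[of "e k"] that EC sub by auto
    show "n > 0" by (rule n)
    show "(\<Sum>k<n. int (\<omega> (e k))) \<le> 4 * letter_weight (\<lambda>k. int (\<omega> (e k))) g 0" if "good g" for g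
    proof -
      have "Z2Z2_flow G g" "edges G - edges C \<subseteq> supp G g"
        using that by (auto simp: good_iff Z2Z2_flow_def)
      then have "real (\<Sum>x \<in> edges C. \<omega> x) \<le> 4 * real (\<Sum>x \<in> {x \<in> edges C. g x = (0, 0)}. \<omega> x)"
        using contra by fastforce
      then have "(\<Sum>x \<in> edges C. \<omega> x) \<le> 4 * (\<Sum>x \<in> {x \<in> edges C. g x = (0, 0)}. \<omega> x)"
        by linarith
      then have "(\<Sum>x \<in> edges C. int (\<omega> x)) \<le> 4 * (\<Sum>x \<in> {x \<in> edges C. g x = (0, 0)}. int (\<omega> x))"
        by (simp flip: of_nat_sum)
      also have "(\<Sum>x \<in> {x \<in> edges C. g x = (0, 0)}. int (\<omega> x)) =
          (\<Sum>x \<in> edges C. of_bool (g x = 0) * int (\<omega> x))"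
        using finite_subset[OF sub finite_E]
        by (intro sum.mono_neutral_cong_left) (auto simp: zero_prod_def)
      finally show ?thesis
        by (simp only: letter_weight_def sum_C[of "\<lambda>x. int (\<omega> x)"]
            sum_C[of "\<lambda>x. of_bool (g x = 0) * int (\<omega> x)"])
    qed
  qed
  have "good f" using D assms(6) by (simp add: good_iff)
  then show False using no_good by blast
qed

end
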